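(* Let $\kappa$ be an uncountable regular cardinal. If every $\kappa$-Knaster partial order is $\kappa$-stationarily layered, then $\square(\kappa)$ fails.
   Context: A partial order is $\kappa$-Knaster if every collection of $\kappa$-many conditions contains a subcollection of cardinality $\kappa$ consisting of pairwise compatible conditions. For a set $A$, $\mathcal{P}_\kappa(A)$ is the collection of all subsets of $A$ of cardinality less than $\kappa$. A subset of $\mathcal{P}_\kappa(A)$ is stationary in $\mathcal{P}_\kappa(A)$ (in Jech's sense) if it meets every subset of $\mathcal{P}_\kappa(A)$ that is $\subseteq$-continuous (closed under unions of $\subseteq$-increasing chains of length less than $\kappa$) and cofinal in $\mathcal{P}_\kappa(A)$. A suborder $\mathbb{Q}$ of $\mathbb{P}$ is regular if the inclusion preserves incompatibility and every maximal antichain of $\mathbb{Q}$ is a maximal antichain of $\mathbb{P}$. A partial order $\mathbb{P}$ is $\kappa$-stationarily layered if the collection of all regular suborders of $\mathbb{P}$ of cardinality less than $\kappa$ is stationary in $\mathcal{P}_\kappa(\mathbb{P})$. For a set $A$ of ordinals, $\mathrm{acc}(A)$ is the set of $\alpha\in A$ with $\alpha>0$ and $\sup(A\cap\alpha)=\alpha$; so $\mathrm{acc}(\kappa)$ is the set of nonzero limit ordinals below $\kappa$. $\square(\kappa)$ is the assertion that there is a sequence $\langle C_\alpha\mid\alpha<\kappa\rangle$ such that (1) for all $\alpha\in\mathrm{acc}(\kappa)$, $C_\alpha$ is a club subset of $\alpha$; (2) if $\alpha,\beta\in\mathrm{acc}(\kappa)$ and $\alpha\in\mathrm{acc}(C_\beta)$,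 then $C_\alpha=C_\beta\cap\alpha$; (3) there is no club $D$ in $\kappa$ such that $D\cap\alpha=C_\alpha$ for all $\alpha\in\mathrm{acc}(D)$. (Entries at non-limit indices are irrelevant.) *)

theory Defs
  imports Main
begin

unbundle cardinal_syntax

(* A cardinal \<kappa> is a relation with Card_order \<kappa>.  The ordinals below \<kappa> are the elements of
   Field \<kappa>, and underS \<kappa> \<alpha> is the ordinal \<alpha> viewed as the set of its predecessors.
   A partial order is a relation R with Partial_order R; its set of conditions is Field R and
   (q, p) \<in> R means q \<le> p.

   HOL has no quantifier over types, so "every partial order" is rendered as every partial order
   whose conditions form a subset of a type 'p.  A theorem that leaves 'p arbitrary, subject only
   to \<kappa> \<le>o |UNIV :: 'p set|, speaks about every such universe of conditions.  The bound is needed: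
   if 'p has fewer than \<kappa> elements, all partial orders on it are trivially \<kappa>-stationarily layered. *)

definition compatible :: "'p rel \<Rightarrow> 'p \<Rightarrow> 'p \<Rightarrow> bool" where
  "compatible R p q \<longleftrightarrow> (\<exists>s\<in>Field R. (s, p) \<in> R \<and> (s, q) \<in> R)"

definition knaster :: "'k rel \<Rightarrow> 'p rel \<Rightarrow> bool" where
  "knaster \<kappa> R \<longleftrightarrow>
     (\<forall>A \<subseteq> Field R. |A| =o \<kappa> \<longrightarrow>
        (\<exists>B \<subseteq> A. |B| =o \<kappa> \<and> (\<forall>p\<in>B. \<forall>q\<in>B. compatible R p q)))"

definition antichain :: "'p rel \<Rightarrow> 'p set \<Rightarrow> bool" where
  "antichain R A \<longleftrightarrow>
     A \<subseteq> Field R \<and> (\<forall>p\<in>A. \<forall>q\<in>A. p \<noteq> q \<longrightarrow> \<not> compatible R p q)"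

definition maximal_antichain :: "'p rel \<Rightarrow> 'p set \<Rightarrow> bool" where
  "maximal_antichain R A \<longleftrightarrow>
     antichain R A \<and> (\<forall>B. antichain R B \<and> A \<subseteq> B \<longrightarrow> B = A)"

(* A suborder is a subset Q of the conditions with the induced order Restr R Q. *)
definition regular_suborder :: "'p rel \<Rightarrow> 'p set \<Rightarrow> bool" where
  "regular_suborder R Q \<longleftrightarrow>
     Q \<subseteq> Field R \<and>
     (\<forall>p\<in>Q. \<forall>q\<in>Q. \<not> compatible (Restr R Q) p q \<longrightarrow> \<not> compatible R p q) \<and>
     (\<forall>A. maximal_antichain (Restr R Q) A \<longrightarrow> maximal_antichain R A)"

definition Pow_less :: "'k rel \<Rightarrow> 'p set \<Rightarrow> 'p set set" where
  "Pow_less \<kappa> A = {x. x \<subseteq> A \<and> |x| <o \<kappa>}"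

(* Chains of length less than \<kappa> are indexed by underS \<kappa> a for a \<in> Field \<kappa>.  Only chains of positive
   length count, so the empty set is not forced into the family. *)
definition chain_closed :: "'k rel \<Rightarrow> 'p set set \<Rightarrow> bool" where
  "chain_closed \<kappa> C \<longleftrightarrow>
     (\<forall>a\<in>Field \<kappa>. \<forall>x.
        underS \<kappa> a \<noteq> {} \<and>
        (\<forall>b\<in>underS \<kappa> a. x b \<in> C) \<and>
        (\<forall>b\<in>underS \<kappa> a. \<forall>c\<in>underS \<kappa> a. (b, c) \<in> \<kappa> \<longrightarrow> x b \<subseteq> x c)
        \<longrightarrow> (\<Union>b\<in>underS \<kappa> a. x b) \<in> C)"

definition cofinal_in_Pow_less :: "'k rel \<Rightarrow> 'p set \<Rightarrow> 'p set set \<Rightarrow> bool" where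
  "cofinal_in_Pow_less \<kappa> A C \<longleftrightarrow> (\<forall>x\<in>Pow_less \<kappa> A. \<exists>y\<in>C. x \<subseteq> y)"

definition stationary_in_Pow_less :: "'k rel \<Rightarrow> 'p set \<Rightarrow> 'p set set \<Rightarrow> bool" where
  "stationary_in_Pow_less \<kappa> A S \<longleftrightarrow>
     S \<subseteq> Pow_less \<kappa> A \<and>
     (\<forall>C \<subseteq> Pow_less \<kappa> A.
        chain_closed \<kappa> C \<and> cofinal_in_Pow_less \<kappa> A C \<longrightarrow> S \<inter> C \<noteq> {})"

definition stationarily_layered :: "'k rel \<Rightarrow> 'p rel \<Rightarrow> bool" where
  "stationarily_layered \<kappa> R \<longleftrightarrow>
     stationary_in_Pow_less \<kappa> (Field R) {Q. regular_suborder R Q \<and> |Q| <o \<kappa>}"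

(* \<alpha> > 0 and sup (A \<inter> \<alpha>) = \<alpha>, where \<alpha> need not belong to A *)
definition limit_of :: "'k rel \<Rightarrow> 'k set \<Rightarrow> 'k \<Rightarrow> bool" where
  "limit_of \<kappa> A \<alpha> \<longleftrightarrow> underS \<kappa> \<alpha> \<noteq> {} \<and> wo_rel.supr \<kappa> (A \<inter> underS \<kappa> \<alpha>) = \<alpha>"

definition acc_pts :: "'k rel \<Rightarrow> 'k set \<Rightarrow> 'k set" where
  "acc_pts \<kappa> A = {\<alpha>\<in>A. limit_of \<kappa> A \<alpha>}"

(* X is meant to be a limit ordinal \<le> \<kappa>: either underS \<kappa> \<alpha> for a limit \<alpha>, or Field \<kappa>. *)
definition club_in :: "'k rel \<Rightarrow> 'k set \<Rightarrow> 'k set \<Rightarrow> bool" where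
  "club_in \<kappa> X C \<longleftrightarrow>
     C \<subseteq> X \<and>
     (\<forall>\<beta>\<in>X. \<exists>\<gamma>\<in>C. (\<beta>, \<gamma>) \<in> \<kappa>) \<and>
     (\<forall>\<beta>\<in>X. limit_of \<kappa> C \<beta> \<longrightarrow> \<beta> \<in> C)"

definition square :: "'k rel \<Rightarrow> bool" where
  "square \<kappa> \<longleftrightarrow>
     (\<exists>C :: 'k \<Rightarrow> 'k set.
        (\<forall>\<alpha>\<in>acc_pts \<kappa> (Field \<kappa>). club_in \<kappa> (underS \<kappa> \<alpha>) (C \<alpha>)) \<and>
        (\<forall>\<alpha>\<in>acc_pts \<kappa> (Field \<kappa>). \<forall>\<beta>\<in>acc_pts \<kappa> (Field \<kappa>).
           \<alpha> \<in> acc_pts \<kappa> (C \<beta>) \<longrightarrow> C \<alpha> = C \<beta> \<inter> underS \<kappa> \<alpha>) \<and>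
        \<not> (\<exists>D. club_in \<kappa> (Field \<kappa>) D \<and>
               (\<forall>\<alpha>\<in>acc_pts \<kappa> D. D \<inter> underS \<kappa> \<alpha> = C \<alpha>)))"

end

theory Submission
  imports Defs
begin

text \<open>
  From a \<open>\<square>(\<kappa>)\<close>-sequence \<open>C\<close> one builds a partial order that is \<open>\<kappa>\<close>-Knaster but not
  \<open>\<kappa>\<close>-stationarily layered.  For a limit \<open>v\<close> and \<open>u < v\<close> put \<open>u \<lhd> v\<close> if \<open>u\<close> is an accumulation point
  of \<open>C v\<close> belonging to \<open>C v\<close>, or the successor of an element of \<open>C v\<close>.  Coherence makes \<open>\<lhd>\<close>
  transitive, and every limit \<open>v\<close> has \<open>\<lhd>\<close>-predecessors cofinal in \<open>v\<close>, whatever its cofinality.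
  The conditions are the finite sets of ordinals below \<open>\<kappa>\<close> without two \<open>\<lhd>\<close>-related elements; larger
  sets are stronger.

  Not layered (\<open>cut_not_regular\<close>): the sets \<open>M \<delta>\<close> of all conditions contained in a limit \<open>\<delta>\<close> form a
  continuous cofinal family.  If \<open>M \<delta>\<close> were regular, then the condition \<open>{\<delta>}\<close> would have a reduct
  \<open>X\<close> in it: every strengthening of \<open>X\<close> inside \<open>M \<delta>\<close> is compatible with \<open>{\<delta>}\<close>.  Take \<open>u \<lhd> \<delta>\<close> above
  \<open>X\<close>.  No element of \<open>X\<close> is related to \<open>u\<close>, for by transitivity it would be related to \<open>\<delta>\<close>.  So
  \<open>insert u X\<close> is a condition in \<open>M \<delta>\<close>, but it is incompatible with \<open>{\<delta>}\<close>.

  Knaster (\<open>knaster_conditions\<close>): given \<open>\<kappa>\<close> many conditions, suppose that for stationarily many \<open>\<delta>\<close>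
  there is one, \<open>P \<delta>\<close>, not contained in \<open>\<delta>\<close>, such that every \<open>\<beta> \<in> P \<delta>\<close> with \<open>\<beta> \<ge> \<delta>\<close> has its
  predecessors below \<open>\<delta>\<close> bounded in \<open>\<delta>\<close>.  Pressing down bounds these predecessors and \<open>P \<delta> \<inter> \<delta>\<close> by
  one ordinal for unboundedly many \<open>\<delta>\<close>, and thinning out makes the sets \<open>P \<delta>\<close> pairwise compatible.
  Otherwise there is an unbounded set of limits \<open>\<delta>\<close> such that each of the given conditions reaching
  beyond \<open>\<delta>\<close> has an element that equals \<open>\<delta>\<close> or lies \<open>\<lhd>\<close>-above it.  Fix the size \<open>n\<close> of the conditions
  and take \<open>n + 1\<close> pairwise unrelated such \<open>\<delta>\<close> (\<open>large_independent\<close>): two of them lie below the same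
  element of a condition, and since the limits below an element are linearly ordered by \<open>\<lhd>\<close>, these
  two are related after all.

  The nontriviality of \<open>C\<close> enters in \<open>ladder_rel_no_branch\<close>: an unbounded set of pairwise related
  limits would thread \<open>C\<close>.  This is what produces large independent sets of limits.
\<close>

section \<open>Reducts to regular suborders\<close>

text \<open>
  If no reduct existed, the elements of \<open>Q\<close> incompatible with \<open>p\<close> would be dense in \<open>Q\<close>.  An antichain
  maximal among those consisting of them is then a maximal antichain of \<open>Q\<close>, hence by regularity one of \<open>R\<close>,
  although \<open>p\<close> is incompatible with all its members.
\<close>
lemma regular_suborder_reduct:
  assumes R: "Partial_order R" and Q: "regular_suborder R Q" and p: "p \<in> Field R"
  shows "\<exists>q\<in>Q. \<forall>r\<in>Q. (r, q) \<in> R \<longrightarrow> compatible R r p"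
proof (rule ccontr)
  assume "\<not> ?thesis"
  then have dense: "\<And>q. q \<in> Q \<Longrightarrow> \<exists>r\<in>Q. (r, q) \<in> R \<and> \<not> compatible R r p" by blast
  have QF: "Q \<subseteq> Field R" using Q unfolding regular_suborder_def by blast
  have refl: "(q, q) \<in> R" if "q \<in> Field R" for q
    using R that unfolding partial_order_on_def preorder_on_def refl_on_def by blast
  have trans: "(a, b) \<in> R \<Longrightarrow> (b, c) \<in> R \<Longrightarrow> (a, c) \<in> R" for a b c
    using R unfolding partial_order_on_def preorder_on_def trans_def by blast
  \<comment> \<open>Zorn's lemma is applied to the antichains of the suborder inside the dense set \<open>D\<close>.\<close>
  define S where "S = Restr R Q"
  have F: "Field S = Q"
  proof
    show "Field S \<subseteq> Q" by (auto simp: Field_def S_def)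
    show "Q \<subseteq> Field S"
      using refl QF unfolding S_def by (blast intro: FieldI1)
  qed
  have compat: "compatible S a b \<longleftrightarrow> (\<exists>s\<in>Q. (s, a) \<in> R \<and> (s, b) \<in> R)"
    if "a \<in> Q" "b \<in> Q" for a b
    using that unfolding compatible_def F by (auto simp: S_def)
  define D where "D = {r\<in>Q. \<not> compatible R r p}"
  define Z where "Z = {A. A \<subseteq> D \<and> antichain S A}"
  have "\<exists>A\<in>Z. \<forall>X\<in>Z. A \<subseteq> X \<longrightarrow> X = A"
  proof (rule subset_Zorn_nonempty)
    have "{} \<in> Z" by (simp add: Z_def antichain_def)
    then show "Z \<noteq> {}" by blast
  next
    fix \<C> assume \<C>: "\<C> \<noteq> {}" "subset.chain Z \<C>"
    have "\<not> compatible S a b" if ab: "a \<in> \<Union>\<C>" "b \<in> \<Union>\<C>" "a \<noteq> b" for a b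
    proof -
      obtain A B where "A \<in> \<C>" "a \<in> A" "B \<in> \<C>" "b \<in> B" using ab by blast
      then obtain E where "E \<in> \<C>" "a \<in> E" "b \<in> E" using \<C>(2) unfolding subset_chain_def by blast
      then show ?thesis using \<C>(2) ab(3) unfolding subset_chain_def Z_def antichain_def by blast
    qed
    moreover have "\<Union>\<C> \<subseteq> D" using \<C>(2) unfolding subset_chain_def Z_def by blast
    moreover have "D \<subseteq> Q" by (auto simp: D_def)
    ultimately show "\<Union>\<C> \<in> Z" unfolding Z_def antichain_def F by blast
  qed
  then obtain A where "A \<in> Z" and A_max: "\<And>X. X \<in> Z \<Longrightarrow> A \<subseteq> X \<Longrightarrow> X = A"
    by blast
  then have A: "A \<subseteq> D" "antichain S A"
    by (simp_all add: Z_def)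
  have "B \<subseteq> A" if B: "antichain S B" "A \<subseteq> B" for B
  proof
    fix b assume b: "b \<in> B"
    have BQ: "B \<subseteq> Q" using B(1) unfolding antichain_def F by blast
    then obtain r where r: "r \<in> Q" "(r, b) \<in> R" "\<not> compatible R r p" using dense b by blast
    have inc: "\<not> compatible S r a" if a: "a \<in> A" "a \<noteq> b" for a
    proof
      assume "compatible S r a"
      moreover have "a \<in> Q" "b \<in> Q" using a B(2) BQ b by blast+
      ultimately have "compatible S b a"
        using compat[of r a] compat[of b a] r trans by blast
      moreover have "\<forall>x\<in>B. \<forall>y\<in>B. x \<noteq> y \<longrightarrow> \<not> compatible S x y"
        using B(1) by (simp add: antichain_def)
      ultimately show False using a B(2) b by (metis subsetD)
    qed
    show "b \<in> A"
    proof (rule ccontr)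
      assume "b \<notin> A"
      then have inc': "\<not> compatible S r a" if "a \<in> A" for a
        using inc[OF that] that by metis
      then have "\<not> compatible S a r" if "a \<in> A" for a
        using that unfolding compatible_def by blast
      then have "antichain S (insert r A)"
        using A(2) r(1) inc' unfolding antichain_def F by blast
      then have "insert r A \<in> Z" using A(1) r by (simp add: Z_def D_def)
      then have "r \<in> A" using A_max by blast
      moreover have "compatible S r r"
        using compat[OF r(1) r(1)] r(1) refl QF by blast
      ultimately show False using inc' by blast
    qed
  qed
  then have "maximal_antichain S A"
    using A(2) unfolding maximal_antichain_def by blast
  then have max: "maximal_antichain R A" using Q unfolding regular_suborder_def S_def by blast
  have "\<not> compatible R a p" "\<not> compatible R p a" if "a \<in> A" for a
    using A(1) that unfolding D_def compatible_def by blast+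
  then have "antichain R (insert p A)"
    using max p unfolding maximal_antichain_def antichain_def by blast
  then have "p \<in> A" using max unfolding maximal_antichain_def by blast
  then have "\<not> compatible R p p" using A(1) unfolding D_def by blast
  then show False using refl p unfolding compatible_def by blast
qed

section \<open>Regular uncountable cardinals\<close>

locale regular_uncountable =
  fixes \<kappa> :: "'k rel"
  assumes card: "Card_order \<kappa>"
    and uncountable: "natLeq <o \<kappa>"
    and regular: "regularCard \<kappa>"
begin

sublocale wo: wo_rel \<kappa>
  using card unfolding wo_rel_def card_order_on_def by simp

abbreviation less :: "'k \<Rightarrow> 'k \<Rightarrow> bool"  (infix "\<prec>" 50) where
  "a \<prec> b \<equiv> a \<in> underS \<kappa> b"

abbreviation leq :: "'k \<Rightarrow> 'k \<Rightarrow> bool"  (infix "\<preceq>" 50) where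
  "a \<preceq> b \<equiv> (a, b) \<in> \<kappa>"

abbreviation limits :: "'k set" where
  "limits \<equiv> acc_pts \<kappa> (Field \<kappa>)"

lemma less_Field: "a \<prec> b \<Longrightarrow> a \<in> Field \<kappa>" "a \<prec> b \<Longrightarrow> b \<in> Field \<kappa>"
  by (auto simp: underS_def Field_def)

lemma less_irrefl: "\<not> a \<prec> a"
  by (simp add: underS_def)

lemma less_imp_leq: "a \<prec> b \<Longrightarrow> a \<preceq> b"
  by (simp add: underS_def)

lemma leq_iff: "a \<preceq> b \<longleftrightarrow> a \<prec> b \<or> a = b \<and> a \<in> Field \<kappa>"
  using wo.REFL by (auto simp: underS_def refl_on_def Field_def)

lemma leq_less_trans: "a \<preceq> b \<Longrightarrow> b \<prec> c \<Longrightarrow> a \<prec> c"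
  using wo.TRANS wo.ANTISYM unfolding underS_def trans_def antisym_def by blast

lemma less_leq_trans: "a \<prec> b \<Longrightarrow> b \<preceq> c \<Longrightarrow> a \<prec> c"
  using wo.TRANS wo.ANTISYM unfolding underS_def trans_def antisym_def by blast

lemma less_trans: "a \<prec> b \<Longrightarrow> b \<prec> c \<Longrightarrow> a \<prec> c"
  using leq_less_trans less_imp_leq by blast

lemma not_less: "a \<in> Field \<kappa> \<Longrightarrow> b \<in> Field \<kappa> \<Longrightarrow> \<not> a \<prec> b \<longleftrightarrow> b \<preceq> a"
  using wo.TOTALS wo.ANTISYM wo.REFL unfolding underS_def antisym_def refl_on_def by blast

lemma less_linear: "a \<in> Field \<kappa> \<Longrightarrow> b \<in> Field \<kappa> \<Longrightarrow> a \<prec> b \<or> a = b \<or> b \<prec> a"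
  using not_less leq_iff by blast

lemma infinite_Field: "\<not> finite (Field \<kappa>)"
proof
  assume "finite (Field \<kappa>)"
  then have "|Field \<kappa>| <o natLeq"
    by (simp add: finite_iff_ordLess_natLeq)
  then have "\<kappa> <o natLeq"
    using card_of_Field_ordIso[OF card] ordIso_ordLess_trans ordIso_symmetric by blast
  then show False
    using uncountable ordLess_transitive ordLess_irreflexive by blast
qed

lemma stable: "stable \<kappa>"
  using regularCard_stable card infinite_Field regular by blast

lemma finite_ordLess: "finite A \<Longrightarrow> |A| <o \<kappa>"
  using finite_iff_ordLess_natLeq uncountable ordLess_transitive by blast

lemma countable_ordLess: "|range (f :: nat \<Rightarrow> 'b)| <o \<kappa>"
proof -
  have "|range f| \<le>o |UNIV :: nat set|"
    by (rule card_of_image)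
  also have "|UNIV :: nat set| =o natLeq"
    by (rule card_of_nat)
  finally show ?thesis
    using uncountable ordLeq_ordLess_trans by blast
qed

lemma greater_exists: "a \<in> Field \<kappa> \<Longrightarrow> \<exists>b. a \<prec> b"
  using infinite_Card_order_limit[OF card infinite_Field] unfolding underS_def by fastforce

lemma small_bounded:
  assumes "A \<subseteq> Field \<kappa>" "|A| <o \<kappa>"
  obtains b where "b \<in> Field \<kappa>" "A \<subseteq> underS \<kappa> b"
proof -
  have "\<not> cofinal A \<kappa>"
    using assms regular not_ordLess_ordIso unfolding regularCard_def by blast
  then obtain a where a: "a \<in> Field \<kappa>" "\<forall>b\<in>A. \<not> a \<prec> b"
    unfolding cofinal_def underS_def by blast
  then obtain b where "a \<prec> b"
    using greater_exists by blast
  then have "A \<subseteq> underS \<kappa> b"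
    using a assms(1) leq_less_trans not_less by blast
  then show ?thesis
    using that less_Field \<open>a \<prec> b\<close> by blast
qed

lemma finite_bounded_below:
  assumes "finite A" "A \<subseteq> underS \<kappa> \<delta>" "underS \<kappa> \<delta> \<noteq> {}"
  shows "\<exists>\<gamma>. \<gamma> \<prec> \<delta> \<and> (\<forall>a\<in>A. a \<preceq> \<gamma>)"
  using assms
proof (induction A rule: finite_induct)
  case empty
  then show ?case by blast
next
  case (insert x A)
  then obtain \<gamma> where \<gamma>: "\<gamma> \<prec> \<delta>" "\<forall>a\<in>A. a \<preceq> \<gamma>"
    by auto
  have x: "x \<prec> \<delta>" using insert by simp
  show ?case
  proof (cases "x \<preceq> \<gamma>")
    case True
    then show ?thesis using \<gamma> by blast
  next
    case False
    then have "\<gamma> \<prec> x"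
      using x \<gamma> less_Field not_less by blast
    then have "a \<preceq> x" if "a \<in> insert x A" for a
      using that \<gamma>(2) leq_less_trans less_imp_leq leq_iff less_Field(2) by (metis insertE)
    then show ?thesis using x by blast
  qed
qed

text \<open>
  Suprema are given by \<open>wo_rel.supr\<close>, a least upper bound in the field; here it is replaced by the
  first-order condition that no smaller ordinal is an upper bound.
\<close>
lemma limit_of_iff:
  assumes "\<alpha> \<in> Field \<kappa>"
  shows "limit_of \<kappa> A \<alpha> \<longleftrightarrow>
    underS \<kappa> \<alpha> \<noteq> {} \<and> (\<forall>\<xi>. \<xi> \<prec> \<alpha> \<longrightarrow> (\<exists>a\<in>A. \<xi> \<prec> a \<and> a \<prec> \<alpha>))"
proof -
  let ?B = "A \<inter> underS \<kappa> \<alpha>"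
  have B: "Above \<kappa> ?B \<subseteq> Field \<kappa>" "\<alpha> \<in> Above \<kappa> ?B"
    using assms less_imp_leq by (auto simp: Above_def)
  have "wo.supr ?B = \<alpha> \<longleftrightarrow> (\<forall>\<xi>. \<xi> \<prec> \<alpha> \<longrightarrow> \<xi> \<notin> Above \<kappa> ?B)"
  proof
    assume "wo.supr ?B = \<alpha>"
    then show "\<forall>\<xi>. \<xi> \<prec> \<alpha> \<longrightarrow> \<xi> \<notin> Above \<kappa> ?B"
      using wo.minim_least[OF B(1)] not_less B less_Field unfolding wo.supr_def by metis
  next
    assume "\<forall>\<xi>. \<xi> \<prec> \<alpha> \<longrightarrow> \<xi> \<notin> Above \<kappa> ?B"
    then show "wo.supr ?B = \<alpha>"
      unfolding wo.supr_def
      using wo.equals_minim[OF B(1) B(2)] B not_less assms by (metis subsetD)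
  qed
  moreover have "\<xi> \<notin> Above \<kappa> ?B \<longleftrightarrow> (\<exists>a\<in>A. \<xi> \<prec> a \<and> a \<prec> \<alpha>)" if "\<xi> \<prec> \<alpha>" for \<xi>
    using that less_Field not_less unfolding Above_def by blast
  ultimately show ?thesis
    unfolding limit_of_def by blast
qed

lemma limits_iff:
  "\<delta> \<in> limits \<longleftrightarrow> underS \<kappa> \<delta> \<noteq> {} \<and> (\<forall>\<xi>. \<xi> \<prec> \<delta> \<longrightarrow> (\<exists>a. \<xi> \<prec> a \<and> a \<prec> \<delta>))"
  using limit_of_iff[of \<delta> "Field \<kappa>"] less_Field unfolding acc_pts_def by blast

definition succ :: "'k \<Rightarrow> 'k" where
  "succ b = wo.suc {b}"

lemma
  assumes "b \<in> Field \<kappa>"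
  shows less_succ: "b \<prec> succ b"
    and succ_least: "b \<prec> c \<Longrightarrow> succ b \<preceq> c"
    and succ_not_limit: "succ b \<notin> limits"
proof -
  obtain d where "b \<prec> d" using greater_exists assms by blast
  then have ne: "AboveS \<kappa> {b} \<noteq> {}"
    using less_Field[of b d] by (auto simp: AboveS_def underS_def)
  show *: "b \<prec> succ b"
    using wo.suc_greater[OF _ ne, of b] assms unfolding succ_def underS_def by auto
  show **: "succ b \<preceq> c" if "b \<prec> c" for c
    using that wo.suc_least_AboveS[of c "{b}"] less_Field
    unfolding succ_def by (auto simp: AboveS_def underS_def)
  show "succ b \<notin> limits"
    using * ** less_leq_trans less_irrefl unfolding limits_iff by blast
qed

lemma succ_less_limit: "\<delta> \<in> limits \<Longrightarrow> b \<prec> \<delta> \<Longrightarrow> succ b \<prec> \<delta>"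
  using succ_least[OF less_Field(1)] leq_less_trans unfolding limits_iff by metis

subsection \<open>Unbounded sets\<close>

definition unbounded :: "'k set \<Rightarrow> bool" where
  "unbounded T \<longleftrightarrow> T \<subseteq> Field \<kappa> \<and> (\<forall>\<xi>\<in>Field \<kappa>. \<exists>t\<in>T. \<xi> \<prec> t)"

lemma unbounded_card:
  assumes "unbounded T"
  shows "|T| =o \<kappa>"
proof -
  have "cofinal T \<kappa>"
    using assms unfolding cofinal_def unbounded_def underS_def by auto
  then show ?thesis
    using assms regular unfolding unbounded_def regularCard_def by blast
qed

lemma unbounded_pigeonhole:
  assumes T: "unbounded T" and h: "h ` T \<subseteq> V" and V: "|V| <o \<kappa>"
  obtains v where "v \<in> V" "unbounded {t\<in>T. h t = v}"
proof (rule ccontr)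
  assume "\<not> thesis"
  then have "\<forall>v\<in>V. \<exists>\<xi>\<in>Field \<kappa>. \<forall>t\<in>T. h t = v \<longrightarrow> \<not> \<xi> \<prec> t"
    using that T unfolding unbounded_def by blast
  then obtain b where b: "\<forall>v\<in>V. b v \<in> Field \<kappa> \<and> (\<forall>t\<in>T. h t = v \<longrightarrow> \<not> b v \<prec> t)"
    by metis
  have "|b ` V| <o \<kappa>"
    using card_of_image V ordLeq_ordLess_trans by blast
  then obtain c where c: "c \<in> Field \<kappa>" "b ` V \<subseteq> underS \<kappa> c"
    using small_bounded[of "b ` V"] b by blast
  then obtain t where "t \<in> T" "c \<prec> t"
    using T unfolding unbounded_def by blast
  then show False
    using b c h less_trans by blast
qed

lemma unbounded_above:
  assumes "unbounded T" "b \<in> Field \<kappa>"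
  shows "unbounded {t\<in>T. b \<prec> t}"
proof -
  have "\<exists>t\<in>T. b \<prec> t \<and> \<xi> \<prec> t" if "\<xi> \<in> Field \<kappa>" for \<xi>
    using assms that less_linear less_trans unfolding unbounded_def by metis
  then show ?thesis using assms unfolding unbounded_def by blast
qed

subsection \<open>Closure points and a pressing-down lemma\<close>

text \<open>
  Closure points take the role of clubs.  For finite-valued \<open>F\<close> they form a club, and every club \<open>D\<close>
  contains all closure points of the function sending \<open>\<gamma>\<close> to the least element of \<open>D\<close> above \<open>\<gamma>\<close>.
  So stationarity below is the usual notion.  Values are finite sets rather than ordinals so that a
  finite condition attached to \<open>\<gamma>\<close> can be a value, and so that two functions combine by union.
\<close>
definition closure_points :: "('k \<Rightarrow> 'k set) \<Rightarrow> 'k set" where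
  "closure_points F = {\<delta>\<in>limits. \<forall>\<gamma>. \<gamma> \<prec> \<delta> \<longrightarrow> F \<gamma> \<subseteq> underS \<kappa> \<delta>}"

definition stationary :: "'k set \<Rightarrow> bool" where
  "stationary S \<longleftrightarrow> (\<forall>F. F ` Field \<kappa> \<subseteq> Fpow (Field \<kappa>) \<longrightarrow> S \<inter> closure_points F \<noteq> {})"

text \<open>
  Start at \<open>\<xi>\<close> and iterate \<open>\<omega>\<close> times a step that passes beyond all values of \<open>F\<close> on smaller ordinals.
  The limit of the iteration is below \<open>\<kappa>\<close> because \<open>\<kappa>\<close> has uncountable cofinality.
\<close>
lemma unbounded_closure_points:
  assumes F: "F ` Field \<kappa> \<subseteq> Fpow (Field \<kappa>)"
  shows "unbounded (closure_points F)"
proof -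
  have F: "finite (F \<gamma>)" "F \<gamma> \<subseteq> Field \<kappa>" if "\<gamma> \<in> Field \<kappa>" for \<gamma>
    using assms that by (auto simp: Fpow_def)
  have ex: "\<exists>b. a \<prec> b \<and> (\<forall>\<gamma>. \<gamma> \<prec> a \<longrightarrow> F \<gamma> \<subseteq> underS \<kappa> b)" if a: "a \<in> Field \<kappa>" for a
  proof -
    have "|\<Union>\<gamma>\<in>underS \<kappa> a. F \<gamma>| <o \<kappa>"
    proof (rule stable_UNION[OF stable])
      show "|underS \<kappa> a| <o \<kappa>"
        by (rule card_of_underS[OF card a])
      show "|F \<gamma>| <o \<kappa>" if "\<gamma> \<prec> a" for \<gamma>
        using F(1) that less_Field(1) finite_ordLess by blast
    qed
    moreover have "(\<Union>\<gamma>\<in>underS \<kappa> a. F \<gamma>) \<subseteq> Field \<kappa>"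
      using F(2) less_Field(1) by (intro UN_least) blast
    ultimately obtain c where c: "c \<in> Field \<kappa>" "(\<Union>\<gamma>\<in>underS \<kappa> a. F \<gamma>) \<subseteq> underS \<kappa> c"
      using small_bounded by (metis (no_types))
    have "|{a, c}| <o \<kappa>" by (simp add: finite_ordLess)
    then obtain b where b: "{a, c} \<subseteq> underS \<kappa> b"
      by (rule small_bounded[rotated]) (use a c in auto)
    have "F \<gamma> \<subseteq> underS \<kappa> b" if "\<gamma> \<prec> a" for \<gamma>
    proof
      fix x assume "x \<in> F \<gamma>"
      then have "x \<prec> c" using c(2) that by blast
      then show "x \<prec> b" using b less_trans[of x c b] by blast
    qed
    then show ?thesis using b by blast
  qed
  then obtain g where g: "\<And>a. a \<in> Field \<kappa> \<Longrightarrow> a \<prec> g a"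
    "\<And>a \<gamma>. a \<in> Field \<kappa> \<Longrightarrow> \<gamma> \<prec> a \<Longrightarrow> F \<gamma> \<subseteq> underS \<kappa> (g a)"
    by metis
  have "\<exists>\<delta>\<in>closure_points F. \<xi> \<prec> \<delta>" if \<xi>: "\<xi> \<in> Field \<kappa>" for \<xi>
  proof -
    define d where "d n = (g ^^ n) \<xi>" for n
    have d: "d n \<in> Field \<kappa>" for n
      by (induction n) (use \<xi> less_Field(2)[OF g(1)] in \<open>auto simp: d_def\<close>)
    have step: "d n \<prec> d (Suc n)" "\<gamma> \<prec> d n \<Longrightarrow> F \<gamma> \<subseteq> underS \<kappa> (d (Suc n))" for n \<gamma>
      using g d[of n] by (auto simp: d_def)
    define A where "A = AboveS \<kappa> (range d)"
    have A_iff: "c \<in> A \<longleftrightarrow> c \<in> Field \<kappa> \<and> (\<forall>n. d n \<prec> c)" for c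
      unfolding A_def AboveS_def underS_def by auto
    then have A: "A \<subseteq> Field \<kappa>" by blast
    obtain b where b: "b \<in> Field \<kappa>" "range d \<subseteq> underS \<kappa> b"
      using small_bounded[of "range d"] countable_ordLess d by blast
    then have "A \<noteq> {}" using A_iff by blast
    define \<delta> where "\<delta> = wo.minim A"
    have \<delta>: "\<delta> \<in> A" "\<And>c. c \<in> A \<Longrightarrow> \<delta> \<preceq> c"
      unfolding \<delta>_def using wo.minim_in[OF A \<open>A \<noteq> {}\<close>] wo.minim_least[OF A] by auto
    have d\<delta>: "d n \<prec> \<delta>" for n
      using \<delta>(1) A_iff by blast
    have below: "\<exists>n. \<gamma> \<prec> d n" if \<gamma>: "\<gamma> \<prec> \<delta>" for \<gamma>
    proof -
      have "\<gamma> \<notin> A"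
        using \<delta>(2)[of \<gamma>] \<gamma> leq_less_trans less_irrefl by blast
      then obtain n where "\<not> d n \<prec> \<gamma>"
        using A_iff less_Field(1)[OF \<gamma>] by blast
      then have "\<gamma> \<preceq> d n"
        using not_less[OF d less_Field(1)[OF \<gamma>]] by blast
      then show ?thesis
        using step(1) leq_less_trans by blast
    qed
    have "\<delta> \<in> limits"
      unfolding limits_iff using d\<delta> below by blast
    moreover have "F \<gamma> \<subseteq> underS \<kappa> \<delta>" if \<gamma>: "\<gamma> \<prec> \<delta>" for \<gamma>
    proof
      fix x assume "x \<in> F \<gamma>"
      obtain n where "\<gamma> \<prec> d n" using below[OF \<gamma>] by blast
      then have "x \<prec> d (Suc n)" using step(2) \<open>x \<in> F \<gamma>\<close> by blast
      then show "x \<prec> \<delta>" using d\<delta> less_trans by blast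
    qed
    ultimately have "\<delta> \<in> closure_points F"
      unfolding closure_points_def by blast
    then show ?thesis
      using d\<delta>[of 0] by (auto simp: d_def)
  qed
  then show ?thesis
    unfolding unbounded_def closure_points_def acc_pts_def by blast
qed

lemma stationary_Int_closure_points:
  assumes "stationary S" "F ` Field \<kappa> \<subseteq> Fpow (Field \<kappa>)"
  shows "stationary (S \<inter> closure_points F)"
  unfolding stationary_def
proof (intro allI impI)
  fix G assume "G ` Field \<kappa> \<subseteq> Fpow (Field \<kappa>)"
  then have "(\<lambda>\<gamma>. F \<gamma> \<union> G \<gamma>) ` Field \<kappa> \<subseteq> Fpow (Field \<kappa>)"
    using assms(2) unfolding Fpow_def by blast
  then have "S \<inter> closure_points (\<lambda>\<gamma>. F \<gamma> \<union> G \<gamma>) \<noteq> {}"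
    using assms(1) unfolding stationary_def by blast
  then show "S \<inter> closure_points F \<inter> closure_points G \<noteq> {}"
    unfolding closure_points_def by blast
qed

text \<open>
  A form of Fodor's lemma: if each \<open>{\<delta>\<in>S. f \<delta> \<le> \<gamma>}\<close> had a bound \<open>g \<gamma>\<close>, then \<open>S\<close> would contain a
  closure point \<open>\<delta>\<close> of \<open>g\<close>, and \<open>g (f \<delta>) < \<delta>\<close> contradicts the choice of \<open>g\<close>.
\<close>
lemma pressing_down:
  assumes S: "stationary S" and f: "\<And>\<delta>. \<delta> \<in> S \<Longrightarrow> f \<delta> \<prec> \<delta>"
  obtains \<gamma> where "\<gamma> \<in> Field \<kappa>" "unbounded {\<delta>\<in>S. f \<delta> \<preceq> \<gamma>}"
proof (rule ccontr)
  assume "\<not> thesis"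
  then have "\<forall>\<gamma>\<in>Field \<kappa>. \<exists>\<xi>\<in>Field \<kappa>. \<forall>\<delta>\<in>S. f \<delta> \<preceq> \<gamma> \<longrightarrow> \<not> \<xi> \<prec> \<delta>"
    using that f less_Field unfolding unbounded_def by blast
  then obtain g where g: "\<forall>\<gamma>\<in>Field \<kappa>. g \<gamma> \<in> Field \<kappa> \<and> (\<forall>\<delta>\<in>S. f \<delta> \<preceq> \<gamma> \<longrightarrow> \<not> g \<gamma> \<prec> \<delta>)"
    by metis
  then have "(\<lambda>\<gamma>. {g \<gamma>}) ` Field \<kappa> \<subseteq> Fpow (Field \<kappa>)"
    by (auto simp: Fpow_def)
  then obtain \<delta> where "\<delta> \<in> S" "\<delta> \<in> closure_points (\<lambda>\<gamma>. {g \<gamma>})"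
    using S unfolding stationary_def by blast
  moreover from this have "f \<delta> \<prec> \<delta>" "f \<delta> \<preceq> f \<delta>"
    using f less_Field leq_iff by blast+
  ultimately show False
    using g less_Field(1)[of "f \<delta>" \<delta>] unfolding closure_points_def by blast
qed

subsection \<open>Finite subsets\<close>

text \<open>
  The subsets of size \<open>n + 1\<close> are images of pairs of an element and a subset of size \<open>n\<close>.
\<close>
lemma card_of_Fpow_le:
  assumes "\<not> finite A"
  shows "|Fpow A| \<le>o |A|"
proof -
  let ?N = "\<lambda>n. {X \<in> Fpow A. card X = n}"
  have "|?N n| \<le>o |A|" for n
  proof (induction n)
    case 0
    have "?N 0 = {{}}" by (auto simp: Fpow_def)
    then show ?case using assms by (auto intro: card_of_singl_ordLeq)
  next
    case (Suc n)
    have "?N (Suc n) \<subseteq> (\<lambda>(a, X). insert a X) ` (A \<times> ?N n)"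
    proof
      fix X assume X: "X \<in> ?N (Suc n)"
      then obtain a Y where "X = insert a Y" "card Y = n"
        by (auto simp: card_Suc_eq)
      then have "(a, Y) \<in> A \<times> ?N n"
        using X by (auto simp: Fpow_def)
      then show "X \<in> (\<lambda>(a, X). insert a X) ` (A \<times> ?N n)"
        using \<open>X = insert a Y\<close> by (auto intro!: image_eqI[of _ _ "(a, Y)"])
    qed
    then have "|?N (Suc n)| \<le>o |A \<times> ?N n|"
      by (rule surj_imp_ordLeq)
    moreover have "|A \<times> ?N n| \<le>o |A|"
      using card_of_Times_mono2[OF Suc] card_of_Times_same_infinite[OF assms]
        ordLeq_ordIso_trans by blast
    ultimately show ?case using ordLeq_transitive by blast
  qed
  moreover have "Fpow A = (\<Union>n. ?N n)" by auto
  moreover have "|UNIV :: nat set| \<le>o |A|"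
    using assms infinite_iff_card_of_nat by blast
  ultimately show ?thesis
    using card_of_UNION_ordLeq_infinite[OF assms] by (metis (no_types, lifting))
qed

lemma Fpow_ordLess:
  assumes "|A| <o \<kappa>"
  shows "|Fpow A| <o \<kappa>"
proof (cases "finite A")
  case True
  then have "finite (Fpow A)"
    using finite_subset[OF Fpow_subset_Pow] by simp
  then show ?thesis
    by (rule finite_ordLess)
next
  case False
  then show ?thesis
    using card_of_Fpow_le assms ordLeq_ordLess_trans by blast
qed

end

section \<open>The poset of finite independent sets\<close>

text \<open>
  What the two halves of the argument need to know about the relation derived from a square
  sequence.  \<open>E_cofinal\<close> and \<open>E_trans\<close> refute layeredness.  For the Knaster property, \<open>E_bounded\<close>
  reflects closure of the clubs, \<open>E_tree\<close> their coherence, and \<open>E_no_branch\<close> the absence of a thread.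
\<close>
locale ladder_order = regular_uncountable \<kappa> for \<kappa> :: "'k rel" +
  fixes E :: "'k \<Rightarrow> 'k \<Rightarrow> bool"  (infix "\<lhd>" 50)
  assumes E_less: "u \<lhd> v \<Longrightarrow> u \<prec> v"
    and E_trans: "u \<lhd> v \<Longrightarrow> v \<lhd> w \<Longrightarrow> u \<lhd> w"
    and E_cofinal: "\<delta> \<in> limits \<Longrightarrow> \<xi> \<prec> \<delta> \<Longrightarrow> \<exists>u. u \<lhd> \<delta> \<and> \<xi> \<prec> u"
    and E_bounded: "\<delta> \<in> limits \<Longrightarrow> \<delta> \<prec> \<beta> \<Longrightarrow> \<not> \<delta> \<lhd> \<beta> \<Longrightarrow>
      \<exists>\<gamma>. \<gamma> \<prec> \<delta> \<and> (\<forall>u. u \<prec> \<delta> \<longrightarrow> u \<lhd> \<beta> \<longrightarrow> u \<preceq> \<gamma>)"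
    and E_tree: "\<delta> \<in> limits \<Longrightarrow> \<delta>' \<in> limits \<Longrightarrow> \<delta> \<lhd> \<beta> \<Longrightarrow> \<delta>' \<lhd> \<beta> \<Longrightarrow> \<delta> \<prec> \<delta>' \<Longrightarrow> \<delta> \<lhd> \<delta>'"
    and E_no_branch: "unbounded T \<Longrightarrow> T \<subseteq> limits \<Longrightarrow> \<exists>a\<in>T. \<exists>b\<in>T. a \<prec> b \<and> \<not> a \<lhd> b"
begin

definition independent :: "'k set \<Rightarrow> bool" where
  "independent X \<longleftrightarrow> (\<forall>u\<in>X. \<forall>v\<in>X. \<not> u \<lhd> v)"

definition conditions :: "'k set set" where
  "conditions = {X \<in> Fpow (Field \<kappa>). independent X}"

lemma not_E_self: "\<not> u \<lhd> u"
  using E_less less_irrefl by blast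

lemma not_E_of_less: "u \<prec> v \<Longrightarrow> \<not> v \<lhd> u"
  using E_less less_trans less_irrefl by blast

lemma finite_upper_bound:
  assumes "finite X" "X \<subseteq> Field \<kappa>"
  obtains b where "b \<in> Field \<kappa>" "X \<subseteq> underS \<kappa> b"
  using small_bounded[OF assms(2) finite_ordLess[OF assms(1)]] by blast

subsection \<open>Large independent sets of limits\<close>

text \<open>
  If some \<open>t \<in> D\<close> beyond \<open>X\<close> is \<open>\<lhd>\<close>-above no element of \<open>X\<close>, add it.  Otherwise some \<open>d \<in> X\<close> lies
  \<open>\<lhd>\<close>-below unboundedly many elements of \<open>D\<close>.  These are not all pairwise related, so there are unrelated
  \<open>s\<close>, \<open>t\<close> above \<open>d\<close>.  Replacing \<open>d\<close> by both preserves independence: another element of \<open>X\<close> that is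
  \<open>\<lhd>\<close>-below \<open>s\<close> or \<open>t\<close> would be related to \<open>d\<close>.
\<close>
lemma larger_independent:
  assumes D: "unbounded D" "D \<subseteq> limits" and X: "finite X" "X \<subseteq> D" "independent X"
  shows "\<exists>Y. finite Y \<and> Y \<subseteq> D \<and> independent Y \<and> card Y = Suc (card X)"
proof -
  have "X \<subseteq> Field \<kappa>" using D X unfolding unbounded_def by blast
  then obtain b where b: "b \<in> Field \<kappa>" "X \<subseteq> underS \<kappa> b"
    using finite_upper_bound X by blast
  define T where "T = {t\<in>D. b \<prec> t}"
  have T: "unbounded T" using unbounded_above D b unfolding T_def by blast
  have XT: "x \<prec> t" if "x \<in> X" "t \<in> T" for x t
    using that b less_trans unfolding T_def by blast
  show ?thesis
  proof (cases "\<exists>t\<in>T. \<forall>x\<in>X. \<not> x \<lhd> t")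
    case True
    then obtain t where t: "t \<in> T" "\<forall>x\<in>X. \<not> x \<lhd> t" by blast
    have "independent (insert t X)"
      using X(3) t XT not_E_self not_E_of_less unfolding independent_def by blast
    moreover have "t \<notin> X" using XT t less_irrefl by blast
    ultimately show ?thesis
      using X t by (intro exI[of _ "insert t X"]) (auto simp: T_def)
  next
    case False
    then obtain h where h: "\<forall>t\<in>T. h t \<in> X \<and> h t \<lhd> t" by metis
    then have "h ` T \<subseteq> X" by blast
    then obtain d where d: "d \<in> X" "unbounded {t\<in>T. h t = d}"
      using unbounded_pigeonhole[OF T _ finite_ordLess[OF X(1)]] by blast
    have "{t\<in>T. h t = d} \<subseteq> limits" using D T_def by blast
    from E_no_branch[OF d(2) this] obtain s t
      where "s \<in> T" "t \<in> T" "h s = d" "h t = d" "s \<prec> t" "\<not> s \<lhd> t" by blast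
    then have st: "s \<in> T" "t \<in> T" "d \<lhd> s" "d \<lhd> t" "s \<prec> t" "\<not> s \<lhd> t"
      using h by auto
    have lim: "x \<in> limits" if "x \<in> X" for x using that X D by blast
    have no: "\<not> x \<lhd> r" if x: "x \<in> X - {d}" and r: "r \<in> T" "d \<lhd> r" for x r
    proof
      assume "x \<lhd> r"
      then have "d \<lhd> x \<or> x \<lhd> d"
        using E_tree[of d x r] E_tree[of x d r] lim d x r less_linear less_Field(1) E_less
        by (metis DiffE singletonI)
      then show False using X(3) d x unfolding independent_def by blast
    qed
    let ?Y = "insert s (insert t (X - {d}))"
    have "s \<noteq> t" "s \<notin> X" "t \<notin> X" using st XT less_irrefl by blast+
    then have "card ?Y = Suc (Suc (card (X - {d})))" using X(1) by simp
    moreover have "Suc (card (X - {d})) = card X" by (rule card_Suc_Diff1[OF X(1) d(1)])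
    moreover have "independent ?Y"
      unfolding independent_def
      using no[OF _ st(1,3)] no[OF _ st(2,4)] st(6) not_E_of_less[OF st(5)] not_E_self
        not_E_of_less[OF XT[OF _ st(1)]] not_E_of_less[OF XT[OF _ st(2)]] X(3)
      unfolding independent_def by blast
    moreover have "?Y \<subseteq> D" using st X unfolding T_def by blast
    ultimately show ?thesis using X(1) by (intro exI[of _ ?Y]) simp
  qed
qed

lemma large_independent:
  assumes "unbounded D" "D \<subseteq> limits"
  shows "\<exists>X. finite X \<and> X \<subseteq> D \<and> independent X \<and> card X = n"
proof (induction n)
  case 0
  then show ?case by (intro exI[of _ "{}"]) (simp add: independent_def)
next
  case (Suc n)
  then show ?case using larger_independent[OF assms] by blast
qed

subsection \<open>The Knaster property\<close>

text \<open>
  For a family of finite sets this amounts to having \<open>\<kappa>\<close> members, but it is the form in which the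
  family is used: it supplies a member reaching beyond any given ordinal.
\<close>
definition spread :: "'k set set \<Rightarrow> bool" where
  "spread \<A> \<longleftrightarrow> (\<forall>\<delta>\<in>Field \<kappa>. \<exists>p\<in>\<A>. \<not> p \<subseteq> underS \<kappa> \<delta>)"

lemma spread_if_card:
  assumes "\<A> \<subseteq> Fpow (Field \<kappa>)" "|\<A>| =o \<kappa>"
  shows "spread \<A>"
  unfolding spread_def
proof (intro ballI, rule ccontr)
  fix \<delta> assume \<delta>: "\<delta> \<in> Field \<kappa>" and "\<not> (\<exists>p\<in>\<A>. \<not> p \<subseteq> underS \<kappa> \<delta>)"
  then have "\<A> \<subseteq> Fpow (underS \<kappa> \<delta>)" using assms(1) by (auto simp: Fpow_def)
  moreover have "|Fpow (underS \<kappa> \<delta>)| <o \<kappa>"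
    by (rule Fpow_ordLess[OF card_of_underS[OF card \<delta>]])
  ultimately have "|\<A>| <o \<kappa>"
    using card_of_mono1 ordLeq_ordLess_trans by blast
  then show False using assms(2) not_ordLess_ordIso by blast
qed

lemma spread_fixed_card:
  assumes "spread \<A>"
  obtains n where "spread {p\<in>\<A>. card p = n}"
proof (rule ccontr)
  assume "\<not> thesis"
  then have not_spread: "\<not> spread {p\<in>\<A>. card p = n}" for n
    using that by blast
  have "\<exists>\<delta>. \<delta> \<in> Field \<kappa> \<and> (\<forall>p\<in>\<A>. card p = n \<longrightarrow> p \<subseteq> underS \<kappa> \<delta>)" for n
    using not_spread[of n] unfolding spread_def by auto
  then obtain d where d: "\<forall>n. d n \<in> Field \<kappa> \<and> (\<forall>p\<in>\<A>. card p = n \<longrightarrow> p \<subseteq> underS \<kappa> (d n))"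
    by metis
  then have "range d \<subseteq> Field \<kappa>" by blast
  then obtain b where b: "b \<in> Field \<kappa>" "range d \<subseteq> underS \<kappa> b"
    using small_bounded[OF _ countable_ordLess] by blast
  then obtain p where p: "p \<in> \<A>" "\<not> p \<subseteq> underS \<kappa> b"
    using assms unfolding spread_def by blast
  have "p \<subseteq> underS \<kappa> (d (card p))" "d (card p) \<prec> b" using d p(1) b(2) by blast+
  then show False using p(2) less_trans by blast
qed

text \<open>
  The case \<open>\<beta> = \<delta>\<close> is excluded together with \<open>\<delta> \<lhd> \<beta>\<close>, because in both cases the predecessors of \<open>\<beta>\<close>
  are unbounded in the limit \<open>\<delta>\<close>.
\<close>
definition free_above :: "'k set \<Rightarrow> 'k \<Rightarrow> bool" where
  "free_above p \<delta> \<longleftrightarrow> (\<forall>\<beta>\<in>p - underS \<kappa> \<delta>. \<beta> \<noteq> \<delta> \<and> \<not> \<delta> \<lhd> \<beta>)"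

text \<open>
  Failing this, there are unboundedly many limits \<open>\<delta>\<close> such that no member of the family that reaches
  beyond \<open>\<delta>\<close> is free above \<open>\<delta>\<close>.  Among these choose \<open>n + 1\<close> pairwise unrelated ones and a member \<open>p\<close>
  of size \<open>n\<close> reaching beyond all of them.  By the pigeonhole principle two of them are equal to or
  below the same element of \<open>p\<close>, which makes them related.
\<close>
lemma stationary_free_above:
  assumes \<A>: "\<A> \<subseteq> Fpow (Field \<kappa>)" "spread \<A>"
  shows "stationary {\<delta>\<in>limits. \<exists>p\<in>\<A>. \<not> p \<subseteq> underS \<kappa> \<delta> \<and> free_above p \<delta>}"
    (is "stationary ?S")
  unfolding stationary_def
proof (intro allI impI notI)
  fix F assume F: "F ` Field \<kappa> \<subseteq> Fpow (Field \<kappa>)" and disj: "?S \<inter> closure_points F = {}"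
  obtain n where n: "spread {p\<in>\<A>. card p = n}"
    using spread_fixed_card \<A>(2) by blast
  let ?D = "closure_points F"
  have D: "unbounded ?D" "?D \<subseteq> limits"
    using unbounded_closure_points[OF F] by (auto simp: closure_points_def)
  then obtain X where X: "finite X" "X \<subseteq> ?D" "independent X" "card X = Suc n"
    using large_independent[OF D, of "Suc n"] by blast
  have "X \<subseteq> Field \<kappa>" using X(2) D unfolding unbounded_def by blast
  then obtain b where b: "b \<in> Field \<kappa>" "X \<subseteq> underS \<kappa> b"
    using finite_upper_bound X(1) by blast
  then obtain p where p: "p \<in> \<A>" "card p = n" "\<not> p \<subseteq> underS \<kappa> b"
    using n unfolding spread_def by blast
  have "\<exists>\<beta>\<in>p. \<delta> = \<beta> \<or> \<delta> \<lhd> \<beta>" if "\<delta> \<in> X" for \<delta>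
  proof -
    have "\<delta> \<prec> b" using that b by blast
    then have "\<not> p \<subseteq> underS \<kappa> \<delta>" using p(3) less_trans by blast
    moreover have "\<delta> \<in> limits" "\<delta> \<notin> ?S" using that X D disj by blast+
    ultimately have "\<not> free_above p \<delta>" using p(1) by blast
    then show ?thesis unfolding free_above_def by blast
  qed
  then obtain h where h: "\<And>\<delta>. \<delta> \<in> X \<Longrightarrow> h \<delta> \<in> p \<and> (\<delta> = h \<delta> \<or> \<delta> \<lhd> h \<delta>)" by metis
  have "finite p" using p \<A> by (auto simp: Fpow_def)
  then have "\<not> inj_on h X"
    using card_inj_on_le[of h X p] h X(4) p(2) by auto
  then obtain s t where st: "s \<in> X" "t \<in> X" "s \<noteq> t" "h s = h t"
    unfolding inj_on_def by blast
  have "s \<in> limits" "t \<in> limits" "s \<in> Field \<kappa>" "t \<in> Field \<kappa>"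
    using st X(2) D \<open>X \<subseteq> Field \<kappa>\<close> by blast+
  then have "s \<lhd> t \<or> t \<lhd> s"
    using h[OF st(1)] h[OF st(2)] st(3,4) less_linear[of s t] E_tree[of s t "h s"] E_tree[of t s "h s"]
    by metis
  then show False using X(3) st unfolding independent_def by blast
qed

text \<open>
  The bound to be pressed down: it takes care of the finitely many elements of \<open>p\<close> below \<open>\<delta>\<close> and of
  the predecessors of the finitely many elements above.
\<close>
lemma bound_below_free:
  assumes p: "finite p" "p \<subseteq> Field \<kappa>" and \<delta>: "\<delta> \<in> limits" and free: "free_above p \<delta>"
  shows "\<exists>\<gamma>. \<gamma> \<prec> \<delta> \<and> (\<forall>u\<in>p. u \<prec> \<delta> \<longrightarrow> u \<preceq> \<gamma>) \<and>
    (\<forall>\<beta>\<in>p - underS \<kappa> \<delta>. \<forall>u. u \<prec> \<delta> \<longrightarrow> u \<lhd> \<beta> \<longrightarrow> u \<preceq> \<gamma>)"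
proof -
  have "\<exists>\<gamma>. \<gamma> \<prec> \<delta> \<and> (\<forall>u. u \<prec> \<delta> \<longrightarrow> u \<lhd> \<beta> \<longrightarrow> u \<preceq> \<gamma>)" if \<beta>: "\<beta> \<in> p - underS \<kappa> \<delta>" for \<beta>
  proof -
    have "\<beta> \<noteq> \<delta>" "\<not> \<delta> \<lhd> \<beta>" using free \<beta> unfolding free_above_def by auto
    moreover have "\<delta> \<in> Field \<kappa>" "\<beta> \<in> Field \<kappa>" using \<delta> \<beta> p by (auto simp: acc_pts_def)
    ultimately have "\<delta> \<prec> \<beta>" using \<beta> less_linear by blast
    then show ?thesis using E_bounded \<delta> \<open>\<not> \<delta> \<lhd> \<beta>\<close> by blast
  qed
  then obtain g where g: "\<And>\<beta>. \<beta> \<in> p - underS \<kappa> \<delta> \<Longrightarrow> g \<beta> \<prec> \<delta>"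
    "\<And>\<beta> u. \<beta> \<in> p - underS \<kappa> \<delta> \<Longrightarrow> u \<prec> \<delta> \<Longrightarrow> u \<lhd> \<beta> \<Longrightarrow> u \<preceq> g \<beta>"
    by metis
  let ?A = "(p \<inter> underS \<kappa> \<delta>) \<union> g ` (p - underS \<kappa> \<delta>)"
  have "finite ?A" "?A \<subseteq> underS \<kappa> \<delta>" "underS \<kappa> \<delta> \<noteq> {}"
    using p g(1) \<delta> by (auto simp: limits_iff)
  then obtain \<gamma> where \<gamma>: "\<gamma> \<prec> \<delta>" "\<And>a. a \<in> ?A \<Longrightarrow> a \<preceq> \<gamma>"
    using finite_bounded_below by metis
  have "u \<preceq> \<gamma>" if "\<beta> \<in> p - underS \<kappa> \<delta>" "u \<prec> \<delta>" "u \<lhd> \<beta>" for \<beta> u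
  proof -
    have "u \<preceq> g \<beta>" by (rule g(2)[OF that])
    moreover have "g \<beta> \<preceq> \<gamma>" using that(1) by (intro \<gamma>(2)) blast
    ultimately show ?thesis using wo.TRANS by (meson transD)
  qed
  moreover have "u \<preceq> \<gamma>" if "u \<in> p" "u \<prec> \<delta>" for u
    using that by (intro \<gamma>(2)) blast
  ultimately show ?thesis using \<gamma>(1) by blast
qed

text \<open>
  The final index set \<open>T'\<close> is obtained from the stationary set of free \<open>\<delta>\<close> in three steps.  Closure
  under \<open>P\<close> puts \<open>P \<delta>\<close> below every later index; pressing down gives one bound for all traces
  \<open>P \<delta> \<inter> \<delta>\<close> and all predecessors below \<open>\<delta>\<close> of elements from \<open>\<delta>\<close> on; and a pigeonhole argument
  makes the trace a constant root \<open>r\<close>.  For \<open>\<delta> < \<delta>'\<close> in \<open>T'\<close>, an element of \<open>P \<delta>\<close> outside the root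
  then lies below \<open>\<delta>'\<close> but above every predecessor that an element of \<open>P \<delta>' - r\<close> has there.
\<close>
lemma knaster_conditions:
  assumes \<A>: "\<A> \<subseteq> conditions" "|\<A>| =o \<kappa>"
  shows "\<exists>\<B>\<subseteq>\<A>. |\<B>| =o \<kappa> \<and> (\<forall>p\<in>\<B>. \<forall>q\<in>\<B>. p \<union> q \<in> conditions)"
proof -
  have \<A>': "\<A> \<subseteq> Fpow (Field \<kappa>)" using \<A> unfolding conditions_def by blast
  define S where "S = {\<delta>\<in>limits. \<exists>p\<in>\<A>. \<not> p \<subseteq> underS \<kappa> \<delta> \<and> free_above p \<delta>}"
  have S: "stationary S"
    unfolding S_def by (rule stationary_free_above[OF \<A>' spread_if_card[OF \<A>' \<A>(2)]])
  have "\<forall>\<delta>\<in>S. \<exists>p. p \<in> \<A> \<and> \<not> p \<subseteq> underS \<kappa> \<delta> \<and> free_above p \<delta>"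
    unfolding S_def by blast
  then obtain P where P: "\<And>\<delta>. \<delta> \<in> S \<Longrightarrow> P \<delta> \<in> \<A> \<and> \<not> P \<delta> \<subseteq> underS \<kappa> \<delta> \<and> free_above (P \<delta>) \<delta>"
    using bchoice[of S "\<lambda>\<delta> p. p \<in> \<A> \<and> \<not> p \<subseteq> underS \<kappa> \<delta> \<and> free_above p \<delta>"] by blast
  have fin: "finite (P \<delta>)" "P \<delta> \<subseteq> Field \<kappa>" "independent (P \<delta>)" if "\<delta> \<in> S" for \<delta>
    using P[OF that] \<A>(1) by (auto simp: conditions_def Fpow_def)
  define F where "F \<delta> = (if \<delta> \<in> S then P \<delta> else {})" for \<delta>
  have F: "F ` Field \<kappa> \<subseteq> Fpow (Field \<kappa>)"
    using fin by (auto simp: F_def Fpow_def)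
  define S' where "S' = S \<inter> closure_points F"
  have S': "stationary S'"
    unfolding S'_def by (rule stationary_Int_closure_points[OF S F])
  have "\<exists>\<gamma>. \<gamma> \<prec> \<delta> \<and> (\<forall>u\<in>P \<delta>. u \<prec> \<delta> \<longrightarrow> u \<preceq> \<gamma>) \<and>
    (\<forall>\<beta>\<in>P \<delta> - underS \<kappa> \<delta>. \<forall>u. u \<prec> \<delta> \<longrightarrow> u \<lhd> \<beta> \<longrightarrow> u \<preceq> \<gamma>)" if "\<delta> \<in> S'" for \<delta>
  proof -
    have "\<delta> \<in> S" "\<delta> \<in> limits" using that unfolding S'_def S_def by auto
    then show ?thesis using bound_below_free[of "P \<delta>" \<delta>] fin P by blast
  qed
  then obtain f where f: "\<And>\<delta>. \<delta> \<in> S' \<Longrightarrow> f \<delta> \<prec> \<delta>"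
    "\<And>\<delta> u. \<delta> \<in> S' \<Longrightarrow> u \<in> P \<delta> \<Longrightarrow> u \<prec> \<delta> \<Longrightarrow> u \<preceq> f \<delta>"
    "\<And>\<delta> \<beta> u. \<delta> \<in> S' \<Longrightarrow> \<beta> \<in> P \<delta> - underS \<kappa> \<delta> \<Longrightarrow> u \<prec> \<delta> \<Longrightarrow> u \<lhd> \<beta> \<Longrightarrow> u \<preceq> f \<delta>"
    by metis
  obtain \<gamma> where \<gamma>: "\<gamma> \<in> Field \<kappa>" "unbounded {\<delta>\<in>S'. f \<delta> \<preceq> \<gamma>}"
    using pressing_down[OF S', of f] f(1) by blast
  \<comment> \<open>Passing from \<open>\<gamma>\<close> to a larger \<open>\<gamma>'\<close> turns the bounds \<open>\<le> \<gamma>\<close> into membership in \<open>\<gamma>'\<close>.\<close>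
  obtain \<gamma>' where \<gamma>': "\<gamma> \<prec> \<gamma>'" using greater_exists \<gamma>(1) by blast
  define T where "T = {\<delta>\<in>{\<delta>\<in>S'. f \<delta> \<preceq> \<gamma>}. \<gamma>' \<prec> \<delta>}"
  have T: "unbounded T"
    unfolding T_def using unbounded_above[OF \<gamma>(2)] less_Field(2)[OF \<gamma>'] by blast
  have root: "u \<prec> \<gamma>'" if "\<delta> \<in> T" "u \<in> P \<delta>" "u \<prec> \<delta>" for \<delta> u
  proof -
    have "u \<preceq> f \<delta>" "f \<delta> \<preceq> \<gamma>" using that f(2) unfolding T_def by auto
    then show ?thesis using \<gamma>' leq_less_trans by blast
  qed
  have free: "\<not> u \<lhd> \<beta>" if "\<delta> \<in> T" "\<beta> \<in> P \<delta>" "\<not> \<beta> \<prec> \<delta>" "u \<prec> \<delta>" "\<not> u \<prec> \<gamma>'" for \<delta> \<beta> u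
  proof
    assume "u \<lhd> \<beta>"
    then have "u \<preceq> f \<delta>" "f \<delta> \<preceq> \<gamma>" using that f(3) unfolding T_def by auto
    then show False using \<gamma>' leq_less_trans that(5) by blast
  qed
  have "(\<lambda>\<delta>. P \<delta> \<inter> underS \<kappa> \<gamma>') ` T \<subseteq> Fpow (underS \<kappa> \<gamma>')"
    using fin(1) unfolding T_def S'_def Fpow_def by auto
  from unbounded_pigeonhole[OF T this Fpow_ordLess[OF card_of_underS[OF card less_Field(2)[OF \<gamma>']]]]
  obtain r where r: "unbounded {\<delta>\<in>T. P \<delta> \<inter> underS \<kappa> \<gamma>' = r}" by blast
  define T' where "T' = {\<delta>\<in>T. P \<delta> \<inter> underS \<kappa> \<gamma>' = r}"
  have T'S: "\<delta> \<in> S" "\<delta> \<in> T" if "\<delta> \<in> T'" for \<delta>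
    using that unfolding T'_def T_def S'_def by auto
  have below: "P \<delta> \<subseteq> underS \<kappa> \<delta>'" if "\<delta> \<in> T'" "\<delta>' \<in> T'" "\<delta> \<prec> \<delta>'" for \<delta> \<delta>'
  proof -
    have "\<delta>' \<in> closure_points F" using that unfolding T'_def T_def S'_def by auto
    then have "F \<delta> \<subseteq> underS \<kappa> \<delta>'" using that(3) unfolding closure_points_def by blast
    then show ?thesis using T'S that(1) unfolding F_def by simp
  qed
  have r_iff: "u \<in> r \<longleftrightarrow> u \<in> P \<delta> \<and> u \<prec> \<gamma>'" if "\<delta> \<in> T'" for u \<delta>
    using that unfolding T'_def by blast
  have compat: "independent (P \<delta> \<union> P \<delta>')" if d: "\<delta> \<in> T'" "\<delta>' \<in> T'" "\<delta> \<prec> \<delta>'" for \<delta> \<delta>'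
  proof -
    have "\<not> u \<lhd> v \<and> \<not> v \<lhd> u" if uv: "u \<in> P \<delta>" "v \<in> P \<delta>'" for u v
    proof (cases "u \<in> r \<or> v \<in> r")
      case True
      then have "u \<in> P \<delta>' \<or> v \<in> P \<delta>" using r_iff d by blast
      then show ?thesis
        using uv fin(3)[OF T'S(1)[OF d(1)]] fin(3)[OF T'S(1)[OF d(2)]] unfolding independent_def
        by blast
    next
      case False
      then have "\<not> v \<prec> \<delta>'" "\<not> u \<prec> \<gamma>'"
        using root[OF T'S(2)[OF d(2)]] r_iff[OF d(1)] r_iff[OF d(2)] uv by blast+
      moreover have "u \<prec> \<delta>'" using below[OF d] uv by blast
      moreover have "v \<in> Field \<kappa>" "\<delta>' \<in> Field \<kappa>" using fin(2)[OF T'S(1)[OF d(2)]] uv d(3) less_Field by auto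
      ultimately show ?thesis
        using free[OF T'S(2)[OF d(2)] uv(2)] not_less[of v \<delta>'] less_leq_trans not_E_of_less by blast
    qed
    then show ?thesis
      using fin(3)[OF T'S(1)[OF d(1)]] fin(3)[OF T'S(1)[OF d(2)]] unfolding independent_def by blast
  qed
  have T'F: "T' \<subseteq> Field \<kappa>" using r unfolding T'_def unbounded_def by blast
  \<comment> \<open>\<open>P t\<close> is not contained in \<open>t\<close>, but \<open>P s\<close> is for \<open>s < t\<close>.\<close>
  have "inj_on P T'"
  proof (rule inj_onI, rule ccontr)
    fix s t assume st: "s \<in> T'" "t \<in> T'" "P s = P t" "s \<noteq> t"
    then have "s \<prec> t \<or> t \<prec> s" using less_linear T'F by blast
    then show False using below[of s t] below[of t s] P[OF T'S(1)] st by metis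
  qed
  then have "|P ` T'| =o |T'|"
    using card_of_ordIsoI[of P T' "P ` T'"] ordIso_symmetric by (auto simp: bij_betw_def)
  also have "|T'| =o \<kappa>" using r unbounded_card unfolding T'_def by blast
  finally have "|P ` T'| =o \<kappa>" .
  moreover have "P ` T' \<subseteq> \<A>" using P T'S by blast
  moreover have "P s \<union> P t \<in> conditions" if st: "s \<in> T'" "t \<in> T'" for s t
  proof -
    have "s \<prec> t \<or> s = t \<or> t \<prec> s" using less_linear T'F st by blast
    then have "independent (P s \<union> P t)"
      using compat[of s t] compat[of t s] st fin(3)[OF T'S(1)] by (auto simp: Un_commute)
    then show ?thesis using fin(1,2)[OF T'S(1)] st unfolding conditions_def Fpow_def by blast
  qed
  ultimately show ?thesis by (intro exI[of _ "P ` T'"]) blast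
qed


subsection \<open>The order on the conditions\<close>

text \<open>
  The map \<open>e\<close>, later an injection on the conditions, moves the order into the given type.
\<close>
definition poset :: "('k set \<Rightarrow> 'p) \<Rightarrow> 'p rel" where
  "poset e = {(e X, e Y) | X Y. X \<in> conditions \<and> Y \<in> conditions \<and> Y \<subseteq> X}"

lemma Field_poset: "Field (poset e) = e ` conditions"
  unfolding poset_def Field_def by auto

lemma poset_iff:
  assumes "inj_on e conditions" "X \<in> conditions" "Y \<in> conditions"
  shows "(e X, e Y) \<in> poset e \<longleftrightarrow> Y \<subseteq> X"
  using assms unfolding poset_def by (auto dest: inj_onD)

lemma Partial_order_poset:
  assumes e: "inj_on e conditions"
  shows "Partial_order (poset e)"
proof -
  have "Refl (poset e)"
    unfolding refl_on_def Field_poset using poset_iff[OF e] by auto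
  moreover have "trans (poset e)"
  proof (rule transI)
    fix x y z assume "(x, y) \<in> poset e" "(y, z) \<in> poset e"
    then obtain X Y Y' Z where "x = e X" "y = e Y" "y = e Y'" "z = e Z"
      "X \<in> conditions" "Y \<in> conditions" "Y' \<in> conditions" "Z \<in> conditions" "Y \<subseteq> X" "Z \<subseteq> Y'"
      unfolding poset_def by blast
    moreover from this have "Y = Y'" using e by (auto dest: inj_onD)
    ultimately show "(x, z) \<in> poset e" using poset_iff[OF e, of X Z] by blast
  qed
  moreover have "antisym (poset e)"
  proof (rule antisymI)
    fix x y assume xy: "(x, y) \<in> poset e" "(y, x) \<in> poset e"
    obtain X Y where "x = e X" "y = e Y" "X \<in> conditions" "Y \<in> conditions"
      using xy(1) unfolding poset_def by blast
    moreover from this have "Y \<subseteq> X" "X \<subseteq> Y"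
      using xy poset_iff[OF e, of X Y] poset_iff[OF e, of Y X] by simp_all
    ultimately show "x = y" by simp
  qed
  ultimately show ?thesis unfolding partial_order_on_def preorder_on_def by (auto intro: FieldI1 FieldI2)
qed

lemma conditions_subset: "X \<in> conditions \<Longrightarrow> Y \<subseteq> X \<Longrightarrow> Y \<in> conditions"
  unfolding conditions_def Fpow_def independent_def by (auto intro: finite_subset)

lemma compatible_poset_iff:
  assumes e: "inj_on e conditions" and XY: "X \<in> conditions" "Y \<in> conditions"
  shows "compatible (poset e) (e X) (e Y) \<longleftrightarrow> X \<union> Y \<in> conditions"
proof
  assume "compatible (poset e) (e X) (e Y)"
  then obtain Z where "Z \<in> conditions" "(e Z, e X) \<in> poset e" "(e Z, e Y) \<in> poset e"
    unfolding compatible_def Field_poset by blast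
  then show "X \<union> Y \<in> conditions"
    using poset_iff[OF e] XY conditions_subset by (metis Un_least)
next
  assume Z: "X \<union> Y \<in> conditions"
  then show "compatible (poset e) (e X) (e Y)"
    unfolding compatible_def Field_poset
    using poset_iff[OF e Z XY(1)] poset_iff[OF e Z XY(2)] by blast
qed

lemma knaster_poset:
  assumes e: "inj_on e conditions"
  shows "knaster \<kappa> (poset e)"
  unfolding knaster_def Field_poset
proof (intro allI impI)
  fix A assume A: "A \<subseteq> e ` conditions" "|A| =o \<kappa>"
  then obtain \<A> where \<A>: "\<A> \<subseteq> conditions" "A = e ` \<A>"
    by (meson subset_image_iff)
  have card_e: "|e ` \<B>| =o |\<B>|" if "\<B> \<subseteq> conditions" for \<B>
    using card_of_ordIsoI[of e \<B> "e ` \<B>"] inj_on_subset[OF e that] ordIso_symmetric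
    by (auto simp: bij_betw_def)
  from ordIso_symmetric[OF this[OF \<A>(1)]] have "|\<A>| =o |A|"
    by (simp add: \<A>(2))
  then have "|\<A>| =o \<kappa>"
    using A(2) by (rule ordIso_transitive)
  then obtain \<B> where \<B>: "\<B> \<subseteq> \<A>" "|\<B>| =o \<kappa>" "\<forall>p\<in>\<B>. \<forall>q\<in>\<B>. p \<union> q \<in> conditions"
    using knaster_conditions[OF \<A>(1)] by blast
  then have "\<B> \<subseteq> conditions" using \<A>(1) by blast
  then have "|e ` \<B>| =o \<kappa>"
    using card_e \<B>(2) ordIso_transitive by blast
  moreover have "\<forall>p\<in>e ` \<B>. \<forall>q\<in>e ` \<B>. compatible (poset e) p q"
  proof (intro ballI)
    fix p q assume "p \<in> e ` \<B>" "q \<in> e ` \<B>"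
    then obtain X Y where XY: "X \<in> \<B>" "Y \<in> \<B>" "p = e X" "q = e Y" by blast
    then have "X \<in> conditions" "Y \<in> conditions" using \<open>\<B> \<subseteq> conditions\<close> by blast+
    from compatible_poset_iff[OF e this] show "compatible (poset e) p q"
      using \<B>(3) XY by simp
  qed
  ultimately show "\<exists>B\<subseteq>A. |B| =o \<kappa> \<and> (\<forall>p\<in>B. \<forall>q\<in>B. compatible (poset e) p q)"
    using \<B>(1) \<A>(2) by (intro exI[of _ "e ` \<B>"]) blast
qed

subsection \<open>Failure of layeredness\<close>

definition cut :: "'k \<Rightarrow> 'k set set" where
  "cut \<delta> = {X \<in> conditions. X \<subseteq> underS \<kappa> \<delta>}"

text \<open>
  A reduct \<open>X\<close> of \<open>{\<delta>}\<close> can be extended, inside the cut, by a \<open>u \<lhd> \<delta>\<close> above \<open>X\<close>: if \<open>v \<in> X\<close> were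
  below \<open>u\<close>, then \<open>v \<lhd> \<delta>\<close> by transitivity, so \<open>X\<close> itself would be incompatible with \<open>{\<delta>}\<close>.
\<close>
lemma cut_not_regular:
  assumes e: "inj_on e conditions" and \<delta>: "\<delta> \<in> limits"
  shows "\<not> regular_suborder (poset e) (e ` cut \<delta>)"
proof
  assume reg: "regular_suborder (poset e) (e ` cut \<delta>)"
  have \<delta>F: "\<delta> \<in> Field \<kappa>" "underS \<kappa> \<delta> \<noteq> {}" using \<delta> limits_iff by (auto simp: acc_pts_def)
  have single: "{\<delta>} \<in> conditions"
    using \<delta>F not_E_self by (auto simp: conditions_def Fpow_def independent_def)
  then have "e {\<delta>} \<in> Field (poset e)" by (auto simp: Field_poset)
  from regular_suborder_reduct[OF Partial_order_poset[OF e] reg this]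
  obtain X where X: "X \<in> cut \<delta>"
    "\<And>Y. Y \<in> cut \<delta> \<Longrightarrow> (e Y, e X) \<in> poset e \<Longrightarrow> compatible (poset e) (e Y) (e {\<delta>})"
    by blast
  have Xc: "X \<in> conditions" "X \<subseteq> underS \<kappa> \<delta>" using X(1) by (auto simp: cut_def)
  have compat: "Y \<union> {\<delta>} \<in> conditions" if "Y \<in> cut \<delta>" "X \<subseteq> Y" for Y
  proof -
    have Y: "Y \<in> conditions" using that by (simp add: cut_def)
    show ?thesis
      using X(2)[OF that(1)] poset_iff[OF e Y Xc(1)] that(2) compatible_poset_iff[OF e Y single]
      by blast
  qed
  have "finite X" using Xc(1) by (simp add: conditions_def Fpow_def)
  then obtain \<gamma> where \<gamma>: "\<gamma> \<prec> \<delta>" "\<forall>v\<in>X. v \<preceq> \<gamma>"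
    using finite_bounded_below Xc(2) \<delta>F(2) by blast
  then obtain u where u: "u \<lhd> \<delta>" "\<gamma> \<prec> u"
    using E_cofinal[OF \<delta>] by blast
  have "\<not> v \<lhd> u \<and> \<not> u \<lhd> v" if v: "v \<in> X" for v
  proof -
    have "\<not> v \<lhd> \<delta>"
      using compat[OF X(1) subset_refl] v by (auto simp: conditions_def independent_def)
    moreover have "v \<prec> u" using \<gamma>(2) v u(2) leq_less_trans by blast
    ultimately show ?thesis using E_trans[OF _ u(1)] not_E_of_less by blast
  qed
  then have "independent (insert u X)"
    using Xc(1) not_E_self unfolding conditions_def independent_def by blast
  then have "insert u X \<in> cut \<delta>"
    using Xc E_less[OF u(1)] less_Field(1) unfolding cut_def conditions_def Fpow_def by auto
  then have "insert u X \<union> {\<delta>} \<in> conditions" using compat by blast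
  then show False using u(1) by (auto simp: conditions_def independent_def)
qed

lemma limits_unbounded: "unbounded limits"
proof -
  have "unbounded (closure_points (\<lambda>_. {}))"
    by (rule unbounded_closure_points) (auto simp: Fpow_def)
  then show ?thesis by (simp add: closure_points_def)
qed

text \<open>
  Continuity of the cuts: \<open>\<delta>\<close> is the supremum of the indices, and a finite subset of \<open>\<delta>\<close> is already
  contained in one of them.
\<close>
lemma cut_UN:
  assumes I: "I \<noteq> {}" "|I| <o \<kappa>" and d: "d ` I \<subseteq> limits"
  shows "\<exists>\<delta>\<in>limits. (\<Union>i\<in>I. cut (d i)) = cut \<delta>"
proof -
  have dF: "d ` I \<subseteq> Field \<kappa>" using d by (auto simp: acc_pts_def)
  moreover have "|d ` I| <o \<kappa>" using card_of_image I(2) ordLeq_ordLess_trans by blast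
  ultimately obtain b where b: "b \<in> Field \<kappa>" "d ` I \<subseteq> underS \<kappa> b"
    using small_bounded by blast
  define A where "A = {c\<in>Field \<kappa>. \<forall>i\<in>I. d i \<preceq> c}"
  have A: "A \<subseteq> Field \<kappa>" "A \<noteq> {}" using b less_imp_leq by (auto simp: A_def)
  define \<delta> where "\<delta> = wo.minim A"
  have \<delta>: "\<delta> \<in> A" "\<And>c. c \<in> A \<Longrightarrow> \<delta> \<preceq> c"
    unfolding \<delta>_def using wo.minim_in[OF A] wo.minim_least[OF A(1)] by auto
  have above: "d i \<preceq> \<delta>" if "i \<in> I" for i using \<delta>(1) that by (simp add: A_def)
  have below: "\<exists>i\<in>I. \<xi> \<prec> d i" if \<xi>: "\<xi> \<prec> \<delta>" for \<xi>
  proof -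
    have "\<xi> \<notin> A" using \<delta>(2)[of \<xi>] \<xi> leq_less_trans less_irrefl by blast
    then obtain i where "i \<in> I" "\<not> d i \<preceq> \<xi>" using less_Field(1)[OF \<xi>] by (auto simp: A_def)
    then show ?thesis using not_less[of \<xi> "d i"] less_Field(1)[OF \<xi>] dF by blast
  qed
  have under: "underS \<kappa> (d i) \<subseteq> underS \<kappa> \<delta>" if "i \<in> I" for i
    using above[OF that] less_leq_trans by blast
  have "\<delta> \<in> limits"
    unfolding limits_iff
  proof (intro conjI allI impI)
    obtain i where "i \<in> I" using I(1) by blast
    then have "underS \<kappa> (d i) \<noteq> {}" using d limits_iff by blast
    then show "underS \<kappa> \<delta> \<noteq> {}" using under[OF \<open>i \<in> I\<close>] by blast
  next
    fix \<xi> assume "\<xi> \<prec> \<delta>"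
    then obtain i where i: "i \<in> I" "\<xi> \<prec> d i" using below by blast
    then have "d i \<in> limits" using d by blast
    then obtain a where "\<xi> \<prec> a" "a \<prec> d i" using i(2) unfolding limits_iff by blast
    then show "\<exists>a. \<xi> \<prec> a \<and> a \<prec> \<delta>" using under[OF i(1)] by blast
  qed
  moreover have "(\<Union>i\<in>I. cut (d i)) = cut \<delta>"
  proof
    show "(\<Union>i\<in>I. cut (d i)) \<subseteq> cut \<delta>" using under unfolding cut_def by blast
  next
    show "cut \<delta> \<subseteq> (\<Union>i\<in>I. cut (d i))"
    proof
      fix X assume X: "X \<in> cut \<delta>"
      then have "finite X" by (simp add: cut_def conditions_def Fpow_def)
      moreover have "X \<subseteq> \<Union> ((\<lambda>i. underS \<kappa> (d i)) ` I)" using X below unfolding cut_def by blast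
      moreover have "subset.chain UNIV ((\<lambda>i. underS \<kappa> (d i)) ` I)"
        unfolding subset_chain_def using wo.ofilter_linord[OF wo.underS_ofilter wo.underS_ofilter] by blast
      ultimately obtain B where "B \<in> (\<lambda>i. underS \<kappa> (d i)) ` I" "X \<subseteq> B"
        using finite_subset_Union_chain[of X "(\<lambda>i. underS \<kappa> (d i)) ` I"] I(1) by blast
      then show "X \<in> (\<Union>i\<in>I. cut (d i))" using X unfolding cut_def by blast
    qed
  qed
  ultimately show ?thesis by blast
qed

lemma not_layered_poset:
  assumes e: "inj_on e conditions"
  shows "\<not> stationarily_layered \<kappa> (poset e)"
proof
  let ?C = "(\<lambda>\<delta>. e ` cut \<delta>) ` limits"
  assume "stationarily_layered \<kappa> (poset e)"
  then have *: "chain_closed \<kappa> ?C \<Longrightarrow> cofinal_in_Pow_less \<kappa> (e ` conditions) ?C \<Longrightarrow>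
      ?C \<subseteq> Pow_less \<kappa> (e ` conditions) \<Longrightarrow> \<exists>Q\<in>?C. regular_suborder (poset e) Q"
    unfolding stationarily_layered_def stationary_in_Pow_less_def Field_poset by blast
  have "\<exists>Q\<in>?C. regular_suborder (poset e) Q"
  proof (rule *)
    show "?C \<subseteq> Pow_less \<kappa> (e ` conditions)"
    proof
      fix Q assume "Q \<in> ?C"
      then obtain \<delta> where \<delta>: "\<delta> \<in> limits" "Q = e ` cut \<delta>" by blast
      have "cut \<delta> \<subseteq> Fpow (underS \<kappa> \<delta>)" by (auto simp: cut_def conditions_def Fpow_def)
      then have "|cut \<delta>| \<le>o |Fpow (underS \<kappa> \<delta>)|" by (rule card_of_mono1)
      moreover have "|Fpow (underS \<kappa> \<delta>)| <o \<kappa>"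
        using Fpow_ordLess[OF card_of_underS[OF card]] \<delta>(1) by (simp add: acc_pts_def)
      ultimately have "|cut \<delta>| <o \<kappa>" by (rule ordLeq_ordLess_trans)
      then have "|Q| <o \<kappa>" unfolding \<delta>(2) by (rule ordLeq_ordLess_trans[OF card_of_image])
      then show "Q \<in> Pow_less \<kappa> (e ` conditions)"
        unfolding Pow_less_def \<delta>(2) cut_def by blast
    qed
    show "chain_closed \<kappa> ?C"
      unfolding chain_closed_def
    proof (intro ballI allI impI, elim conjE)
      fix a x assume a: "a \<in> Field \<kappa>" "underS \<kappa> a \<noteq> {}" and x: "\<forall>b\<in>underS \<kappa> a. x b \<in> ?C"
      have "\<forall>b\<in>underS \<kappa> a. \<exists>\<delta>. \<delta> \<in> limits \<and> x b = e ` cut \<delta>" using x by blast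
      then obtain d where d: "\<forall>b\<in>underS \<kappa> a. d b \<in> limits \<and> x b = e ` cut (d b)"
        using bchoice by metis
      then obtain \<delta> where "\<delta> \<in> limits" "(\<Union>b\<in>underS \<kappa> a. cut (d b)) = cut \<delta>"
        using cut_UN[OF a(2) card_of_underS[OF card a(1)], of d] by blast
      moreover have "(\<Union>b\<in>underS \<kappa> a. x b) = e ` (\<Union>b\<in>underS \<kappa> a. cut (d b))"
        using d by (simp add: image_UN)
      ultimately show "(\<Union>b\<in>underS \<kappa> a. x b) \<in> ?C" by auto
    qed
    show "cofinal_in_Pow_less \<kappa> (e ` conditions) ?C"
      unfolding cofinal_in_Pow_less_def
    proof
      fix x assume "x \<in> Pow_less \<kappa> (e ` conditions)"
      then have x: "x \<subseteq> e ` conditions" "|x| <o \<kappa>" by (auto simp: Pow_less_def)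
      define G where "G = inv_into conditions e"
      have G: "G y \<in> conditions" "e (G y) = y" if "y \<in> x" for y
        using x(1) that inv_into_into f_inv_into_f unfolding G_def by (metis subsetD)+
      have "|\<Union>y\<in>x. G y| <o \<kappa>"
        using G(1) finite_ordLess by (intro stable_UNION[OF stable x(2)]) (auto simp: conditions_def Fpow_def)
      moreover have "(\<Union>y\<in>x. G y) \<subseteq> Field \<kappa>" using G(1) by (auto simp: conditions_def Fpow_def)
      ultimately obtain b where b: "b \<in> Field \<kappa>" "(\<Union>y\<in>x. G y) \<subseteq> underS \<kappa> b"
        using small_bounded by (metis (no_types))
      obtain \<delta> where \<delta>: "\<delta> \<in> limits" "b \<prec> \<delta>"
        using limits_unbounded b(1) unfolding unbounded_def by blast
      have "y \<in> e ` cut \<delta>" if y: "y \<in> x" for y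
      proof -
        have "G y \<subseteq> underS \<kappa> \<delta>"
        proof
          fix u assume "u \<in> G y"
          then have "u \<prec> b" using b(2) y by blast
          then show "u \<prec> \<delta>" using \<delta>(2) less_trans by blast
        qed
        then have "G y \<in> cut \<delta>" using G(1)[OF y] by (simp add: cut_def)
        then show ?thesis using G(2)[OF y] by (metis imageI)
      qed
      then show "\<exists>y\<in>?C. x \<subseteq> y" using \<delta>(1) by blast
    qed
  qed
  then show False using cut_not_regular[OF e] by blast
qed

end

section \<open>The order of a square sequence\<close>

locale square_sequence = regular_uncountable \<kappa> for \<kappa> :: "'k rel" +
  fixes C :: "'k \<Rightarrow> 'k set"
  assumes club: "\<alpha> \<in> limits \<Longrightarrow> club_in \<kappa> (underS \<kappa> \<alpha>) (C \<alpha>)"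
    and coherent: "\<alpha> \<in> limits \<Longrightarrow> \<beta> \<in> limits \<Longrightarrow> \<alpha> \<in> acc_pts \<kappa> (C \<beta>) \<Longrightarrow>
      C \<alpha> = C \<beta> \<inter> underS \<kappa> \<alpha>"
    and no_thread: "club_in \<kappa> (Field \<kappa>) D \<Longrightarrow>
      \<exists>\<alpha>\<in>acc_pts \<kappa> D. D \<inter> underS \<kappa> \<alpha> \<noteq> C \<alpha>"
begin

text \<open>
  If \<open>v\<close> has cofinality \<open>\<omega>\<close>, the accumulation points of \<open>C v\<close> need not be cofinal in \<open>v\<close>.  So all
  elements of \<open>C v\<close> contribute predecessors of \<open>v\<close>, but they do so through their successors: a successor
  ordinal has no predecessors, so transitivity has to be checked only at accumulation points, where
  the sequence coheres.
\<close>
definition ladder_rel :: "'k \<Rightarrow> 'k \<Rightarrow> bool" where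
  "ladder_rel u v \<longleftrightarrow> v \<in> limits \<and> u \<prec> v \<and> (u \<in> acc_pts \<kappa> (C v) \<or> (\<exists>b\<in>C v. u = succ b))"

lemma C_below: "\<alpha> \<in> limits \<Longrightarrow> C \<alpha> \<subseteq> underS \<kappa> \<alpha>"
  using club unfolding club_in_def by blast

lemma acc_pts_limit: "u \<in> acc_pts \<kappa> A \<Longrightarrow> u \<in> limits"
proof -
  assume u: "u \<in> acc_pts \<kappa> A"
  then have "underS \<kappa> u \<noteq> {}" by (simp add: acc_pts_def limit_of_def)
  then have uF: "u \<in> Field \<kappa>" using less_Field by blast
  show ?thesis
    using u limits_iff[of u] limit_of_iff[OF uF, of A] unfolding acc_pts_def by blast
qed

lemma limit_of_cong:
  "A \<inter> underS \<kappa> u = B \<inter> underS \<kappa> u \<Longrightarrow> limit_of \<kappa> A u \<longleftrightarrow> limit_of \<kappa> B u"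
  by (simp add: limit_of_def)

lemma acc_pts_restrict:
  assumes "u \<prec> v"
  shows "u \<in> acc_pts \<kappa> (A \<inter> underS \<kappa> v) \<longleftrightarrow> u \<in> acc_pts \<kappa> A"
proof -
  have "A \<inter> underS \<kappa> v \<inter> underS \<kappa> u = A \<inter> underS \<kappa> u"
    using assms less_trans by blast
  then show ?thesis
    using limit_of_cong[of "A \<inter> underS \<kappa> v" u A] assms by (simp add: acc_pts_def)
qed

lemma ladder_rel_limit:
  assumes u: "u \<in> limits"
  shows "ladder_rel u v \<longleftrightarrow> v \<in> limits \<and> u \<prec> v \<and> u \<in> acc_pts \<kappa> (C v)"
proof -
  have "u \<noteq> succ b" if "v \<in> limits" "b \<in> C v" for b
    using succ_not_limit[of b] C_below[OF that(1)] that(2) less_Field(1) u by blast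
  then show ?thesis unfolding ladder_rel_def by blast
qed

lemma ladder_rel_coherent:
  assumes "u \<in> limits" "ladder_rel u v"
  shows "C u = C v \<inter> underS \<kappa> u"
  using assms coherent ladder_rel_limit by blast

lemma ladder_rel_trans:
  assumes uv: "ladder_rel u v" and vw: "ladder_rel v w"
  shows "ladder_rel u w"
proof -
  have v: "v \<in> limits" and w: "w \<in> limits" using uv vw by (auto simp: ladder_rel_def)
  have C: "C v = C w \<inter> underS \<kappa> v" by (rule ladder_rel_coherent[OF v vw])
  have uv': "u \<prec> v" "v \<prec> w" using uv vw by (auto simp: ladder_rel_def)
  then have "u \<prec> w" using less_trans by blast
  moreover have "u \<in> acc_pts \<kappa> (C w) \<or> (\<exists>b\<in>C w. u = succ b)"
    using uv acc_pts_restrict[OF uv'(1), of "C w"] C unfolding ladder_rel_def by auto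
  ultimately show ?thesis using w unfolding ladder_rel_def by blast
qed

lemma ladder_rel_cofinal:
  assumes \<delta>: "\<delta> \<in> limits" and \<xi>: "\<xi> \<prec> \<delta>"
  shows "\<exists>u. ladder_rel u \<delta> \<and> \<xi> \<prec> u"
proof -
  obtain b where b: "b \<in> C \<delta>" "\<xi> \<preceq> b"
    using club[OF \<delta>] \<xi> unfolding club_in_def by blast
  have b\<delta>: "b \<prec> \<delta>" using C_below[OF \<delta>] b(1) by blast
  have "\<xi> \<prec> succ b" using leq_less_trans[OF b(2)] less_succ[OF less_Field(1)[OF b\<delta>]] by blast
  moreover have "ladder_rel (succ b) \<delta>"
    unfolding ladder_rel_def using \<delta> succ_less_limit[OF \<delta> b\<delta>] b(1) by blast
  ultimately show ?thesis by blast
qed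

text \<open>
  If \<open>\<beta>\<close> is a limit, then \<open>C \<beta> \<inter> \<delta>\<close> has a bound \<open>\<gamma> < \<delta>\<close>, for otherwise \<open>\<delta>\<close> would be an accumulation
  point in the closed set \<open>C \<beta>\<close>.  The predecessors of \<open>\<beta>\<close> below \<open>\<delta>\<close> are elements of \<open>C \<beta>\<close> or
  successors of such, so \<open>succ \<gamma>\<close> bounds them.
\<close>
lemma ladder_rel_bounded:
  assumes \<delta>: "\<delta> \<in> limits" and less: "\<delta> \<prec> \<beta>" and no: "\<not> ladder_rel \<delta> \<beta>"
  shows "\<exists>\<gamma>. \<gamma> \<prec> \<delta> \<and> (\<forall>u. u \<prec> \<delta> \<longrightarrow> ladder_rel u \<beta> \<longrightarrow> u \<preceq> \<gamma>)"
proof (cases "\<beta> \<in> limits")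
  case False
  then have "\<not> ladder_rel u \<beta>" for u by (simp add: ladder_rel_def)
  then show ?thesis using \<delta> limits_iff by blast
next
  case True
  have "\<not> limit_of \<kappa> (C \<beta>) \<delta>"
  proof
    assume "limit_of \<kappa> (C \<beta>) \<delta>"
    then have "\<delta> \<in> acc_pts \<kappa> (C \<beta>)"
      using club[OF True] less unfolding club_in_def acc_pts_def by blast
    then show False using no True less unfolding ladder_rel_def by blast
  qed
  then obtain \<gamma> where \<gamma>: "\<gamma> \<prec> \<delta>" "\<And>a. a \<in> C \<beta> \<Longrightarrow> \<gamma> \<prec> a \<Longrightarrow> \<not> a \<prec> \<delta>"
    using limit_of_iff[OF less_Field(1)[OF less]] \<delta> limits_iff by metis
  have \<gamma>F: "\<gamma> \<in> Field \<kappa>" by (rule less_Field(1)[OF \<gamma>(1)])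
  have small: "a \<preceq> \<gamma>" if "a \<in> C \<beta>" "a \<prec> \<delta>" for a
    using \<gamma>(2)[OF that(1)] that(2) not_less[OF \<gamma>F less_Field(1)[OF that(2)]] by blast
  have "u \<preceq> succ \<gamma>" if u: "u \<prec> \<delta>" "ladder_rel u \<beta>" for u
  proof -
    consider "u \<in> C \<beta>" | b where "b \<in> C \<beta>" "u = succ b"
      using u(2) unfolding ladder_rel_def acc_pts_def by blast
    then show ?thesis
    proof cases
      case 1
      then have "u \<preceq> \<gamma>" using small u(1) by blast
      then show ?thesis using leq_less_trans less_succ[OF \<gamma>F] less_imp_leq by blast
    next
      case 2
      then have bF: "b \<in> Field \<kappa>" using C_below[OF True] less_Field(1) by blast
      have "b \<prec> \<delta>" using less_trans[OF less_succ[OF bF]] 2(2) u(1) by blast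
      then have "b \<preceq> \<gamma>" using small 2(1) by blast
      then have "b \<prec> succ \<gamma>" using leq_less_trans less_succ[OF \<gamma>F] by blast
      then show ?thesis using succ_least[OF bF] 2(2) by blast
    qed
  qed
  then show ?thesis using succ_less_limit[OF \<delta> \<gamma>(1)] by blast
qed

lemma ladder_rel_tree:
  assumes "\<delta> \<in> limits" "\<delta>' \<in> limits" "ladder_rel \<delta> \<beta>" "ladder_rel \<delta>' \<beta>" "\<delta> \<prec> \<delta>'"
  shows "ladder_rel \<delta> \<delta>'"
proof -
  have "C \<delta>' = C \<beta> \<inter> underS \<kappa> \<delta>'" by (rule ladder_rel_coherent[OF assms(2,4)])
  moreover have "\<delta> \<in> acc_pts \<kappa> (C \<beta>)" using ladder_rel_limit assms(1,3) by blast
  ultimately show ?thesis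
    using acc_pts_restrict[OF assms(5), of "C \<beta>"] assms(2,5) unfolding ladder_rel_def by simp
qed

text \<open>
  If all elements of \<open>T\<close> were related, the clubs \<open>C a\<close> for \<open>a \<in> T\<close> would be initial segments of each
  other and their union a thread.
\<close>
lemma ladder_rel_no_branch:
  assumes T: "unbounded T" "T \<subseteq> limits"
  shows "\<exists>a\<in>T. \<exists>b\<in>T. a \<prec> b \<and> \<not> ladder_rel a b"
proof (rule ccontr)
  assume "\<not> ?thesis"
  then have chain: "ladder_rel a b" if "a \<in> T" "b \<in> T" "a \<prec> b" for a b
    using that by blast
  have TF: "T \<subseteq> Field \<kappa>" using T(1) by (simp add: unbounded_def)
  define D where "D = (\<Union>a\<in>T. C a)"
  have D_below: "D \<inter> underS \<kappa> a = C a" if a: "a \<in> T" for a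
  proof
    show "C a \<subseteq> D \<inter> underS \<kappa> a" using a C_below[of a] T(2) unfolding D_def by blast
  next
    have "C b \<inter> underS \<kappa> a \<subseteq> C a" if b: "b \<in> T" for b
    proof -
      consider "a = b" | "a \<prec> b" | "b \<prec> a" using less_linear a b TF by blast
      then show ?thesis
      proof cases
        case 1
        then show ?thesis by simp
      next
        case 2
        then show ?thesis using ladder_rel_coherent chain[OF a b] T(2) a by blast
      next
        case 3
        then show ?thesis using ladder_rel_coherent[of b a] chain[OF b a] T(2) b by blast
      qed
    qed
    then show "D \<inter> underS \<kappa> a \<subseteq> C a" unfolding D_def by blast
  qed
  have above: "\<exists>a\<in>T. \<xi> \<prec> a" if "\<xi> \<in> Field \<kappa>" for \<xi>
    using T(1) that unfolding unbounded_def by blast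
  have lim_C: "limit_of \<kappa> D \<beta> \<longleftrightarrow> limit_of \<kappa> (C a) \<beta>" if "a \<in> T" "\<beta> \<prec> a" for a \<beta>
  proof (rule limit_of_cong)
    show "D \<inter> underS \<kappa> \<beta> = C a \<inter> underS \<kappa> \<beta>"
      using D_below[OF that(1)] less_trans that(2) by blast
  qed
  have "club_in \<kappa> (Field \<kappa>) D"
    unfolding club_in_def
  proof (intro conjI ballI impI)
    show "D \<subseteq> Field \<kappa>" unfolding D_def using C_below T(2) less_Field(1) by blast
  next
    fix \<beta> assume "\<beta> \<in> Field \<kappa>"
    then obtain a where a: "a \<in> T" "\<beta> \<prec> a" using above by blast
    then show "\<exists>\<gamma>\<in>D. \<beta> \<preceq> \<gamma>" using club[of a] T(2) unfolding club_in_def D_def by blast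
  next
    fix \<beta> assume \<beta>: "\<beta> \<in> Field \<kappa>" "limit_of \<kappa> D \<beta>"
    then obtain a where a: "a \<in> T" "\<beta> \<prec> a" using above by blast
    then have "limit_of \<kappa> (C a) \<beta>" using lim_C \<beta>(2) by blast
    then have "\<beta> \<in> C a" using club[of a] a T(2) unfolding club_in_def by blast
    then show "\<beta> \<in> D" using a(1) unfolding D_def by blast
  qed
  then obtain \<alpha> where \<alpha>: "\<alpha> \<in> acc_pts \<kappa> D" "D \<inter> underS \<kappa> \<alpha> \<noteq> C \<alpha>"
    using no_thread by blast
  have \<alpha>lim: "\<alpha> \<in> limits" by (rule acc_pts_limit[OF \<alpha>(1)])
  then have "\<alpha> \<in> Field \<kappa>" by (simp add: acc_pts_def)
  then obtain a where a: "a \<in> T" "\<alpha> \<prec> a" using above by blast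
  have Da: "D \<inter> underS \<kappa> a = C a" by (rule D_below[OF a(1)])
  then have "\<alpha> \<in> acc_pts \<kappa> (C a)" using acc_pts_restrict[OF a(2), of D] \<alpha>(1) by simp
  then have "C \<alpha> = C a \<inter> underS \<kappa> \<alpha>" using coherent \<alpha>lim a(1) T(2) by blast
  also have "\<dots> = D \<inter> underS \<kappa> \<alpha>" using Da less_trans a(2) by blast
  finally show False using \<alpha>(2) by blast
qed

sublocale ladder_order \<kappa> ladder_rel
proof unfold_locales
  show "ladder_rel u v \<Longrightarrow> u \<prec> v" for u v by (simp add: ladder_rel_def)
qed (fact ladder_rel_trans ladder_rel_cofinal ladder_rel_bounded ladder_rel_tree ladder_rel_no_branch)+

end

section \<open>Failure of square\<close>

text \<open>
  There are only \<open>\<kappa>\<close> many conditions, so they can be injected into the type of the hypothesis.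
\<close>
theorem theorem1p6:
  fixes \<kappa> :: "'k rel"
  assumes "Card_order \<kappa>" and "natLeq <o \<kappa>" and "regularCard \<kappa>"
    and "\<kappa> \<le>o |UNIV :: 'p set|"
    and "\<forall>R :: 'p rel. Partial_order R \<and> knaster \<kappa> R \<longrightarrow> stationarily_layered \<kappa> R"
  shows "\<not> square \<kappa>"
proof
  assume "square \<kappa>"
  then obtain C :: "'k \<Rightarrow> 'k set" where C:
    "\<forall>\<alpha>\<in>acc_pts \<kappa> (Field \<kappa>). club_in \<kappa> (underS \<kappa> \<alpha>) (C \<alpha>)"
    "\<forall>\<alpha>\<in>acc_pts \<kappa> (Field \<kappa>). \<forall>\<beta>\<in>acc_pts \<kappa> (Field \<kappa>).
       \<alpha> \<in> acc_pts \<kappa> (C \<beta>) \<longrightarrow> C \<alpha> = C \<beta> \<inter> underS \<kappa> \<alpha>"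
    "\<not> (\<exists>D. club_in \<kappa> (Field \<kappa>) D \<and> (\<forall>\<alpha>\<in>acc_pts \<kappa> D. D \<inter> underS \<kappa> \<alpha> = C \<alpha>))"
    unfolding square_def by blast
  interpret regular_uncountable \<kappa>
    using assms(1-3) by unfold_locales
  interpret square_sequence \<kappa> C
    using C by unfold_locales blast+
  have "|conditions| \<le>o |Fpow (Field \<kappa>)|"
    by (rule card_of_mono1) (auto simp: conditions_def)
  also have "|Fpow (Field \<kappa>)| \<le>o |Field \<kappa>|"
    by (rule card_of_Fpow_le[OF infinite_Field])
  also have "|Field \<kappa>| =o \<kappa>"
    by (rule card_of_Field_ordIso[OF card])
  also note \<open>\<kappa> \<le>o |UNIV :: 'p set|\<close>
  finally have "|conditions| \<le>o |UNIV :: 'p set|" .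
  then obtain e :: "'k set \<Rightarrow> 'p" where e: "inj_on e conditions"
    using card_of_ordLeq[of conditions "UNIV :: 'p set"] by auto
  show False
    using assms(5)[rule_format, of "poset e"] Partial_order_poset[OF e] knaster_poset[OF e]
      not_layered_poset[OF e] by simp
qed


end
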